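(* Let $N,N_t$ be integers with $2\le N\le N_t$, and let $\rho>0$, $T>0$. Consider the orthogonal random precoding scheme with $N$ precoding vectors and a single-antenna receiver, with downlink coverage probability $$\mathcal P^{(T)}=\mathbf P\Big\{\max_{n=1,\dots,N}SINR_n>T\Big\}.$$ Then $$\mathcal P^{(T)}=\begin{cases}\dfrac{N}{(T+1)^{N-1}}\,e^{-TN/\rho}, & T\ge 1,\\[2mm] \mathcal P^{(T)}_1+\displaystyle\sum_{k=2}^{m-1}\mathcal P^{(T)}_k+\mathcal P^{(T)}_m, & T<1,\end{cases}$$ where $m=\lceil 1/T\rceil$ and $$\mathcal P^{(T)}_1=\frac{N}{(N-2)!}\left(e^{-TN/\rho}C_1+C_2\right),$$ $$\mathcal P^{(T)}_k=\xi_k\!\left(e^{-TN/\rho}\frac{T^l}{l!}D_1-\frac{1}{(k-1)^l\,l!}D_2\right)+\xi_k\!\left(\frac{1}{k^l\,l!}E_1-\frac{1}{(k-1)^l\,l!}E_2\right),$$ $$\mathcal P^{(T)}_m=\xi_m\!\left(e^{-TN/\rho}\frac{T^l}{l!}F_1-\frac{1}{(m-1)^l\,l!}F_2\right).$$ Here the function $\xi_p(\cdot)$, $p=1,\dots,N-1$, is defined by $$\xi_p(\cdot)=\frac{N}{(N-2)!}\sum_{t=1}^{p}\binom{N-1}{t-1}(-1)^{t+1}\sum_{i=0}^{N-2}\binom{N-2}{i}(1-t)^i\,i!\sum_{l=0}^{i}(\cdot),$$ and $C_1,C_2,D_1,D_2,E_1,E_2,F_1,F_2$ are the explicit quantities given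 in the context.
   Context: Model. $h\in\mathbb C^{N_t\times 1}$ has i.i.d. circularly symmetric complex Gaussian entries $\mathcal{CN}(0,1)$. $\phi_1,\dots,\phi_N\in\mathbb C^{N_t\times1}$ are (random) orthonormal precoding vectors, independent of $h$. $\rho>0$ is the average SNR. The signal-to-interference-plus-noise ratio of the $n$th beam is $$SINR_n=\frac{|h^T\phi_n|^2}{\frac N\rho+\sum_{i\ne n,\,1\le i\le N}|h^T\phi_i|^2},\qquad n=1,\dots,N.$$ Auxiliary quantities (used for $T<1$). The argument of $\xi_p(\cdot)$ is an expression that may depend on the summation indices $i,l$, and is summed over them; $0^0=1$. For $k=1,\dots,N-1$, $$b_k=\frac{TN}{\rho(1/k-T)}.$$ The quantities $D_1,D_2,E_1,E_2$ depend on $k,i,l$, and $F_1,F_2$ on $m,i,l$: $$C_1=\frac{(N-2)!}{(T+1)^{N-1}}\Big(1-e^{-(T+1)b_1}\sum_{l=0}^{N-2}\frac{(T+1)^lb_1^l}{l!}\Big),\qquad C_2=\frac{(N-2)!}{2^{N-1}}e^{-2b_1}\sum_{l=0}^{N-2}\frac{2^lb_1^l}{l!},$$ $$D_1=\sum_{v=0}^{l}\binom lv\Big(\frac N\rho\Big)^{l-v}\frac{(N-i+v-2)!}{(T+1)^{N-i+v-1}}\sum_{u=0}^{N-i+v-2}\frac{(T+1)^u}{u!}\Big(e^{-(T+1)b_{k-1}}b_{k-1}^u-e^{-(T+1)b_k}b_k^u\Big),$$ $$D_2=\frac{(N-i+l-2)!}{(\frac{k}{k-1})^{N-i+l-1}}\Big[e^{-\frac{k}{k-1}b_{k-1}}\sum_{u=0}^{N-i+l-2}\Big(\frac{k}{k-1}\Big)^u\frac{b_{k-1}^u}{u!}-e^{-\frac{k}{k-1}b_k}\sum_{u=0}^{N-i+l-2}\Big(\frac{k}{k-1}\Big)^u\frac{b_k^u}{u!}\Big],$$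 $$E_1=\frac{(N-i+l-2)!}{(\frac{k+1}{k})^{N-i+l-1}}e^{-\frac{k+1}{k}b_k}\sum_{u=0}^{N-i+l-2}\Big(\frac{k+1}{k}\Big)^u\frac{b_k^u}{u!},$$ $$E_2=\frac{(N-i+l-2)!}{(\frac{k}{k-1})^{N-i+l-1}}e^{-\frac{k}{k-1}b_k}\sum_{u=0}^{N-i+l-2}\Big(\frac{k}{k-1}\Big)^u\frac{b_k^u}{u!},$$ $$F_1=\sum_{v=0}^{l}\binom lv\Big(\frac N\rho\Big)^{l-v}\frac{(N-i+v-2)!}{(T+1)^{N-i+v-1}}e^{-(T+1)b_{m-1}}\sum_{u=0}^{N-i+v-2}(T+1)^u\frac{b_{m-1}^u}{u!},$$ $$F_2=\frac{(N-i+l-2)!}{(\frac{m}{m-1})^{N-i+l-1}}e^{-\frac{m}{m-1}b_{m-1}}\sum_{u=0}^{N-i+l-2}\Big(\frac{m}{m-1}\Big)^u\frac{b_{m-1}^u}{u!}.$$ *)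

theory Defs
  imports "HOL-Probability.Probability"
begin

(* indep_var requires both random variables to have the same value type; this is the same
   notion for two different value types. *)
definition (in prob_space) indep_rv ::
  "'b measure \<Rightarrow> ('a \<Rightarrow> 'b) \<Rightarrow> 'c measure \<Rightarrow> ('a \<Rightarrow> 'c) \<Rightarrow> bool" where
  "indep_rv S X T Y \<longleftrightarrow>
    random_variable S X \<and> random_variable T Y \<and>
    indep_set (sigma_sets (space M) {X -` A \<inter> space M | A. A \<in> sets S})
              (sigma_sets (space M) {Y -` A \<inter> space M | A. A \<in> sets T})"

lemma (in prob_space) indep_rv_iff_indep_var: "indep_rv S X T Y \<longleftrightarrow> indep_var S X T Y"
  unfolding indep_rv_def indep_var_eq by blast

(* Density, with respect to Lebesgue measure on the complex plane, of the circularly symmetric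
   complex Gaussian law CN(0, v): v is the total variance E|Z|^2, so the real and the imaginary
   part each have variance v/2. *)
definition cn_density :: "real \<Rightarrow> complex \<Rightarrow> real" where
  "cn_density v z = exp (- (cmod z)\<^sup>2 / v) / (pi * v)"

lemma cn_density_eq_normal:
  assumes "v > 0"
  shows "cn_density v z =
    normal_density 0 (sqrt (v / 2)) (Re z) * normal_density 0 (sqrt (v / 2)) (Im z)"
proof -
  have "exp (- (cmod z)\<^sup>2 / v) = exp (- (Re z)\<^sup>2 / v) * exp (- (Im z)\<^sup>2 / v)"
    by (simp add: cmod_power2 mult_exp_exp diff_divide_distrib)
  moreover have "sqrt (pi * v) * sqrt (pi * v) = pi * v"
    using assms by simp
  ultimately show ?thesis
    using assms by (simp add: cn_density_def normal_density_def)
qed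

definition hermitian_inner :: "complex ^ 'n \<Rightarrow> complex ^ 'n \<Rightarrow> complex" where
  "hermitian_inner x y = (\<Sum>j\<in>UNIV. cnj (x $ j) * y $ j)"

definition orthonormal_on :: "nat set \<Rightarrow> (nat \<Rightarrow> complex ^ 'n) \<Rightarrow> bool" where
  "orthonormal_on I f \<longleftrightarrow>
    (\<forall>a\<in>I. \<forall>b\<in>I. hermitian_inner (f a) (f b) = (if a = b then 1 else 0))"

(* scalar_product is the bilinear product, without conjugation, as in h^T phi. *)
definition SINR :: "nat \<Rightarrow> real \<Rightarrow> complex ^ 'n \<Rightarrow> (nat \<Rightarrow> complex ^ 'n) \<Rightarrow> nat \<Rightarrow> real" where
  "SINR N \<rho> h \<phi> n =
    (cmod (scalar_product h (\<phi> n)))\<^sup>2 /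
    (real N / \<rho> + (\<Sum>i\<in>{1..N} - {n}. (cmod (scalar_product h (\<phi> i)))\<^sup>2))"

definition coverage_prob ::
  "'w measure \<Rightarrow> nat \<Rightarrow> real \<Rightarrow> real \<Rightarrow> ('w \<Rightarrow> complex ^ 'n) \<Rightarrow> (nat \<Rightarrow> 'w \<Rightarrow> complex ^ 'n) \<Rightarrow> real"
  where
  "coverage_prob M N \<rho> T h \<phi> =
    measure M {\<omega> \<in> space M. (MAX n\<in>{1..N}. SINR N \<rho> (h \<omega>) (\<lambda>i. \<phi> i \<omega>) n) > T}"

definition bb :: "nat \<Rightarrow> real \<Rightarrow> real \<Rightarrow> nat \<Rightarrow> real" where
  "bb N \<rho> T k = T * real N / (\<rho> * (1 / real k - T))"

(* The bracketed argument of xi is passed as a function of the summation indices i and l.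
   The formula is used for every p, with the usual convention that the binomial coefficient
   vanishes for t > N: the index p can be N or larger when T is small. *)
definition xi :: "nat \<Rightarrow> nat \<Rightarrow> (nat \<Rightarrow> nat \<Rightarrow> real) \<Rightarrow> real" where
  "xi N p g = real N / fact (N - 2) *
    (\<Sum>t=1..p. real ((N - 1) choose (t - 1)) * (-1) ^ (t + 1) *
      (\<Sum>i=0..N-2. real ((N - 2) choose i) * (1 - real t) ^ i * fact i *
        (\<Sum>l=0..i. g i l)))"

definition C1 :: "nat \<Rightarrow> real \<Rightarrow> real \<Rightarrow> real" where
  "C1 N \<rho> T = fact (N - 2) / (T + 1) ^ (N - 1) *
    (1 - exp (- (T + 1) * bb N \<rho> T 1) *
      (\<Sum>l=0..N-2. (T + 1) ^ l * bb N \<rho> T 1 ^ l / fact l))"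

definition C2 :: "nat \<Rightarrow> real \<Rightarrow> real \<Rightarrow> real" where
  "C2 N \<rho> T = fact (N - 2) / 2 ^ (N - 1) * exp (- 2 * bb N \<rho> T 1) *
    (\<Sum>l=0..N-2. 2 ^ l * bb N \<rho> T 1 ^ l / fact l)"

definition D1 :: "nat \<Rightarrow> real \<Rightarrow> real \<Rightarrow> nat \<Rightarrow> nat \<Rightarrow> nat \<Rightarrow> real" where
  "D1 N \<rho> T k i l =
    (\<Sum>v=0..l. real (l choose v) * (real N / \<rho>) ^ (l - v) *
      (fact (N - i + v - 2) / (T + 1) ^ (N - i + v - 1)) *
      (\<Sum>u=0..N-i+v-2. (T + 1) ^ u / fact u *
        (exp (- (T + 1) * bb N \<rho> T (k - 1)) * bb N \<rho> T (k - 1) ^ u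
         - exp (- (T + 1) * bb N \<rho> T k) * bb N \<rho> T k ^ u)))"

definition D2 :: "nat \<Rightarrow> real \<Rightarrow> real \<Rightarrow> nat \<Rightarrow> nat \<Rightarrow> nat \<Rightarrow> real" where
  "D2 N \<rho> T k i l =
    (let r = real k / (real k - 1) in
      fact (N - i + l - 2) / r ^ (N - i + l - 1) *
      (exp (- r * bb N \<rho> T (k - 1)) * (\<Sum>u=0..N-i+l-2. r ^ u * (bb N \<rho> T (k - 1) ^ u / fact u))
       - exp (- r * bb N \<rho> T k) * (\<Sum>u=0..N-i+l-2. r ^ u * (bb N \<rho> T k ^ u / fact u))))"

definition E1 :: "nat \<Rightarrow> real \<Rightarrow> real \<Rightarrow> nat \<Rightarrow> nat \<Rightarrow> nat \<Rightarrow> real" where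
  "E1 N \<rho> T k i l =
    (let r = (real k + 1) / real k in
      fact (N - i + l - 2) / r ^ (N - i + l - 1) * exp (- r * bb N \<rho> T k) *
      (\<Sum>u=0..N-i+l-2. r ^ u * (bb N \<rho> T k ^ u / fact u)))"

definition E2 :: "nat \<Rightarrow> real \<Rightarrow> real \<Rightarrow> nat \<Rightarrow> nat \<Rightarrow> nat \<Rightarrow> real" where
  "E2 N \<rho> T k i l =
    (let r = real k / (real k - 1) in
      fact (N - i + l - 2) / r ^ (N - i + l - 1) * exp (- r * bb N \<rho> T k) *
      (\<Sum>u=0..N-i+l-2. r ^ u * (bb N \<rho> T k ^ u / fact u)))"

definition F1 :: "nat \<Rightarrow> real \<Rightarrow> real \<Rightarrow> nat \<Rightarrow> nat \<Rightarrow> nat \<Rightarrow> real" where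
  "F1 N \<rho> T m i l =
    (\<Sum>v=0..l. real (l choose v) * (real N / \<rho>) ^ (l - v) *
      (fact (N - i + v - 2) / (T + 1) ^ (N - i + v - 1)) *
      exp (- (T + 1) * bb N \<rho> T (m - 1)) *
      (\<Sum>u=0..N-i+v-2. (T + 1) ^ u * (bb N \<rho> T (m - 1) ^ u / fact u)))"

definition F2 :: "nat \<Rightarrow> real \<Rightarrow> real \<Rightarrow> nat \<Rightarrow> nat \<Rightarrow> nat \<Rightarrow> real" where
  "F2 N \<rho> T m i l =
    (let r = real m / (real m - 1) in
      fact (N - i + l - 2) / r ^ (N - i + l - 1) * exp (- r * bb N \<rho> T (m - 1)) *
      (\<Sum>u=0..N-i+l-2. r ^ u * (bb N \<rho> T (m - 1) ^ u / fact u)))"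

definition P_first :: "nat \<Rightarrow> real \<Rightarrow> real \<Rightarrow> real" where
  "P_first N \<rho> T =
    real N / fact (N - 2) * (exp (- T * real N / \<rho>) * C1 N \<rho> T + C2 N \<rho> T)"

definition P_mid :: "nat \<Rightarrow> real \<Rightarrow> real \<Rightarrow> nat \<Rightarrow> real" where
  "P_mid N \<rho> T k =
    xi N k (\<lambda>i l. exp (- T * real N / \<rho>) * (T ^ l / fact l) * D1 N \<rho> T k i l
                   - 1 / ((real k - 1) ^ l * fact l) * D2 N \<rho> T k i l)
    + xi N k (\<lambda>i l. 1 / (real k ^ l * fact l) * E1 N \<rho> T k i l
                     - 1 / ((real k - 1) ^ l * fact l) * E2 N \<rho> T k i l)"

definition P_last :: "nat \<Rightarrow> real \<Rightarrow> real \<Rightarrow> nat \<Rightarrow> real" where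
  "P_last N \<rho> T m =
    xi N m (\<lambda>i l. exp (- T * real N / \<rho>) * (T ^ l / fact l) * F1 N \<rho> T m i l
                   - 1 / ((real m - 1) ^ l * fact l) * F2 N \<rho> T m i l)"

end

theory Submission
  imports Defs "HOL-Real_Asymp.Real_Asymp"
begin

text \<open>
  Conditionally on the orthonormal vectors, the numbers $X_n = |h^T\phi_n|^2$ are independent and
  exponentially distributed, because the Gaussian law of $h$ is invariant under unitary maps.
  With $R = N/\rho$, the event that some SINR exceeds $T$ is, up to ties, the disjoint union over $n$
  of the events that $X_n$ is the maximum and $X_n > T(R + \sum_{j \neq n} X_j)$.  Inclusion-exclusion over the set
  of the $j$ with $X_j > X_n$ and the memoryless property turn its probability into an alternating sum over
  $s$ of the integrals of $e^{-x-y}(y - s x)^{N-2}$ over the region $y \ge s x$, $x > T(R + y)$,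
  which is empty as soon as $s T \ge 1$.  Such an integral is evaluated by two explicit antiderivatives.  The formula of the
  paper cuts the region along the lines $y = k x$, and its terms telescope in $k$ to these integrals.
\<close>

section \<open>Explicit antiderivatives\<close>

text \<open>The power of y - s x arises as follows. Let x be the power of one beam and y the sum of
  the other N - 1 powers. Requiring s of these to exceed x costs the factor exp(-s x) and shifts the
  sum by s x, so y - s x gets the Erlang density of shape N - 1. In exp(-s x) * exp(-(y - s x)) the
  terms s x cancel, and only the polynomial factor remembers s. For s >= 1 with s T < 1 the lines x
  = T (R + y) and x = y / s cross at y = b_s, which is the origin of \<open>bb\<close>; the region
  is the wedge between them beyond b_s. For s = 0 there is no second line, and for T >= 1 this is
  the only surviving term. The index t of \<open>xi\<close> is s + 1. The closed formula mixes the
  integrand for s with the wedges below x = y / k for various k >= s, k >= 1; apart from the s = 0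
  terms, which cancel against the first summand, only k = s survives. All antiderivatives are
  normalised to vanish at infinity, so a wedge contributes just a value at its vertex b_k.\<close>

text \<open>
  The value of $\int_a^\infty y^n e^{-cy}\,dy$.
\<close>

definition upper_gamma :: "nat \<Rightarrow> real \<Rightarrow> real \<Rightarrow> real" where
  "upper_gamma n c a = fact n / c ^ (n + 1) * (exp (- c * a) * (\<Sum>u=0..n. (c * a) ^ u / fact u))"

text \<open>Integration by parts. The recursion reduces the derivative and the limit at infinity to
  the case n = 0.\<close>

lemma upper_gamma_Suc:
  assumes "c \<noteq> 0"
  shows "upper_gamma (Suc n) c a = (1 + real n) / c * upper_gamma n c a + a ^ Suc n * exp (- c * a) / c"
proof -
  have "upper_gamma (Suc n) c a = fact (Suc n) / (c * c ^ (n+1)) *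
      (exp (- c * a) * ((\<Sum>u=0..n. (c * a) ^ u / fact u) + (c * a) ^ Suc n / fact (Suc n)))"
    unfolding upper_gamma_def by simp
  also have "\<dots> = (1 + real n) * fact n / (c * c ^ (n+1)) *
      (exp (- c * a) * (\<Sum>u=0..n. (c * a) ^ u / fact u))
     + fact (Suc n) / (c * c ^ (n+1)) * (exp (- c * a) * ((c * a) ^ Suc n / fact (Suc n)))"
    by (simp only: distrib_left fact_Suc of_nat_Suc)
  also have "fact (Suc n) / (c * c ^ (n+1)) * (exp (- c * a) * ((c * a) ^ Suc n / fact (Suc n)))
      = a ^ Suc n * exp (- c * a) / c"
    using assms by (simp add: field_simps power_mult_distrib del: fact_Suc)
  finally show ?thesis by (simp add: upper_gamma_def)
qed

lemma upper_gamma_0: "upper_gamma n c 0 = fact n / c ^ (n + 1)"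
  by (simp add: upper_gamma_def power_0_left if_distrib[of "\<lambda>x. x / _"] sum.delta cong: if_cong)

lemma DERIV_upper_gamma:
  assumes "c \<noteq> 0"
  shows "(upper_gamma n c has_real_derivative - (x ^ n * exp (- c * x))) (at x)"
proof (induction n)
  case 0
  have "upper_gamma 0 c = (\<lambda>a. exp (- c * a) / c)" by (auto simp: upper_gamma_def)
  then show ?case
    using assms by (auto intro!: derivative_eq_intros)
next
  case (Suc n)
  have eq: "upper_gamma (Suc n) c =
      (\<lambda>a. (1 + real n) / c * upper_gamma n c a + a ^ Suc n * exp (- c * a) / c)"
    using upper_gamma_Suc[OF assms] by blast
  show ?case unfolding eq
    using assms
    by (auto intro!: derivative_eq_intros Suc.IH simp del: power_Suc) (simp add: field_simps)
qed

text \<open>Together with the derivative, this singles out the antiderivative that vanishes at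
  infinity, hence the improper integral.\<close>

lemma upper_gamma_tendsto_0:
  assumes "c > 0"
  shows "(upper_gamma n c \<longlongrightarrow> 0) at_top"
proof (induction n)
  case 0
  have "upper_gamma 0 c = (\<lambda>a. exp (- c * a) / c)" by (auto simp: upper_gamma_def)
  moreover have "((\<lambda>a. exp (- c * a) / c) \<longlongrightarrow> 0) at_top"
    using assms by real_asymp
  ultimately show ?case by simp
next
  case (Suc n)
  have eq: "upper_gamma (Suc n) c =
      (\<lambda>a. (1 + real n) / c * upper_gamma n c a + a ^ Suc n * exp (- c * a) / c)"
    using upper_gamma_Suc assms by (metis less_irrefl)
  have "((\<lambda>a. a ^ Suc n * exp (- c * a) / c) \<longlongrightarrow> 0) at_top"
    using assms by real_asymp
  from tendsto_add[OF tendsto_mult_left[OF Suc, of "(1 + real n) / c"] this]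
  show ?case unfolding eq by simp
qed

text \<open>
  The value of $\int_a^\infty e^{-x}(y - s x)^n\,dx$.
\<close>

definition tail_poly :: "nat \<Rightarrow> real \<Rightarrow> real \<Rightarrow> real \<Rightarrow> real" where
  "tail_poly n s y a = (\<Sum>i=0..n. real (n choose i) * (- s) ^ i * y ^ (n - i) * upper_gamma i 1 a)"

lemma DERIV_tail_poly:
  "((\<lambda>x. tail_poly n s y x) has_real_derivative - (exp (- x) * (y - s * x) ^ n)) (at x)"
proof -
  have "(y - s * x) ^ n = (- s * x + y) ^ n" by simp
  also have "\<dots> = (\<Sum>i\<le>n. real (n choose i) * (- s * x) ^ i * y ^ (n - i))"
    by (rule binomial_ring)
  finally have "exp (- x) * (y - s * x) ^ n
      = (\<Sum>i=0..n. real (n choose i) * (- s) ^ i * y ^ (n - i) * (x ^ i * exp (- 1 * x)))"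
    by (simp only: sum_distrib_left atLeast0AtMost power_mult_distrib)
      (simp add: mult_ac)
  then show ?thesis
    unfolding tail_poly_def
    by (auto intro!: derivative_eq_intros DERIV_upper_gamma sum.cong simp: sum_negf[symmetric])
qed

text \<open>
  Up to the binomial weights collected in \<open>binsum\<close>, \<open>threshold_tail\<close> and \<open>ray_tail\<close> are the
  integrals over \<open>y' \<ge> y\<close> of \<open>exp (- y') * tail_poly n s y' a\<close>, where \<open>a\<close> is \<open>T * (R + y')\<close> and \<open>y' / k\<close>,
  respectively.  They correspond to the quantities $D_1, F_1$ and to $D_2, E_1, E_2, F_2$.
\<close>

definition threshold_tail :: "nat \<Rightarrow> real \<Rightarrow> real \<Rightarrow> nat \<Rightarrow> nat \<Rightarrow> real \<Rightarrow> real" where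
  "threshold_tail n R T i l y = exp (- T * R) * (T ^ l / fact l) *
     (\<Sum>v=0..l. real (l choose v) * R ^ (l - v) * upper_gamma (n - i + v) (T + 1) y)"

definition ray_tail :: "nat \<Rightarrow> real \<Rightarrow> nat \<Rightarrow> nat \<Rightarrow> real \<Rightarrow> real" where
  "ray_tail n k i l y = 1 / (k ^ l * fact l) * upper_gamma (n - i + l) ((k + 1) / k) y"

text \<open>The powers of \<open>- s\<close> come from expanding \<open>(y - s * x) ^ n\<close>,
  while \<open>fact i\<close> and the sum over \<open>l\<close> come from
  \<open>upper_gamma i 1 a\<close>. With \<open>s = t - 1\<close> these are the weights of
  \<open>xi\<close>.\<close>

definition binsum :: "nat \<Rightarrow> real \<Rightarrow> (nat \<Rightarrow> nat \<Rightarrow> real) \<Rightarrow> real" where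
  "binsum n s g = (\<Sum>i=0..n. real (n choose i) * (- s) ^ i * fact i * (\<Sum>l=0..i. g i l))"

lemma binsum_diff: "binsum n s (\<lambda>i l. f i l - g i l) = binsum n s f - binsum n s g"
  by (simp add: binsum_def sum_subtractf right_diff_distrib)

text \<open>At the lower end a = T (R + y) the exponents combine to - T R - (T + 1) y, and the
  binomial theorem writes (R + y)^l in powers of y. This is the sum over v in \<open>D1\<close> and
  \<open>F1\<close>.\<close>

lemma DERIV_threshold_tail:
  assumes "T > -1"
  shows "(threshold_tail n R T i l has_real_derivative
    - (exp (- y) * y ^ (n - i) * exp (- (T * (R + y))) * ((T * (R + y)) ^ l / fact l))) (at y)"
proof -
  have "(T * (R + y)) ^ l = T ^ l * (y + R) ^ l" by (simp add: power_mult_distrib add.commute)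
  also have "(y + R) ^ l = (\<Sum>v\<le>l. real (l choose v) * y ^ v * R ^ (l - v))"
    by (rule binomial_ring)
  finally have p: "(T * (R + y)) ^ l = T ^ l * (\<Sum>v=0..l. real (l choose v) * R ^ (l - v) * y ^ v)"
    by (simp add: atLeast0AtMost mult_ac)
  have e: "exp (- (T * (R + y))) * exp (- y) = exp (- T * R) * exp (- (T + 1) * y)"
    by (simp add: exp_add[symmetric] algebra_simps)
  have d: "(threshold_tail n R T i l has_real_derivative
     exp (- T * R) * (T ^ l / fact l) *
     (\<Sum>v=0..l. real (l choose v) * R ^ (l - v) * - (y ^ (n - i + v) * exp (- (T + 1) * y)))) (at y)"
    unfolding threshold_tail_def using assms
    by (auto intro!: derivative_eq_intros DERIV_upper_gamma sum.cong)
  have "exp (- T * R) * (T ^ l / fact l) *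
     (\<Sum>v=0..l. real (l choose v) * R ^ (l - v) * - (y ^ (n - i + v) * exp (- (T + 1) * y)))
   = - ((exp (- T * R) * exp (- (T + 1) * y)) * y ^ (n - i) * (T ^ l * (\<Sum>v=0..l. real (l choose v) * R ^ (l - v) * y ^ v) / fact l))"
    by (simp add: sum_distrib_left sum_distrib_right sum_divide_distrib power_add sum_negf mult_ac)
  also have "\<dots> = - (exp (- y) * y ^ (n - i) * exp (- (T * (R + y))) * ((T * (R + y)) ^ l / fact l))"
    unfolding p[symmetric] e[symmetric] by (simp add: mult_ac)
  finally show ?thesis using d by simp
qed

text \<open>At a = y / k the two exponentials combine to the rate (k + 1) / k. The rate k / (k - 1)
  in \<open>D2\<close>, \<open>E2\<close> and \<open>F2\<close> belongs to the ray with k -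
  1.\<close>

lemma DERIV_ray_tail:
  assumes "k > 0"
  shows "(ray_tail n k i l has_real_derivative
    - (exp (- y) * y ^ (n - i) * exp (- (y / k)) * ((y / k) ^ l / fact l))) (at y)"
proof -
  have e: "exp (- y) * exp (- (y / k)) = exp (- ((k + 1) / k) * y)"
    using assms by (simp add: exp_add[symmetric] field_simps)
  have "(ray_tail n k i l has_real_derivative
     1 / (k ^ l * fact l) * - (y ^ (n - i + l) * exp (- ((k + 1) / k) * y))) (at y)"
    unfolding ray_tail_def using assms by (auto intro!: derivative_eq_intros DERIV_upper_gamma)
  moreover have "1 / (k ^ l * fact l) * - (y ^ (n - i + l) * exp (- ((k + 1) / k) * y))
    = - (exp (- y) * y ^ (n - i) * exp (- (y / k)) * ((y / k) ^ l / fact l))"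
    unfolding e[symmetric] by (simp add: power_add power_divide)
  ultimately show ?thesis by simp
qed

text \<open>Expanding \<open>upper_gamma i 1 a\<close> into its sum over l produces the double sum
  of the formula, so the outer integration can be done for each pair (i, l) separately.\<close>

lemma tail_poly_binsum:
  "binsum n s (\<lambda>i l. exp (- y) * y ^ (n - i) * exp (- a) * (a ^ l / fact l)) = exp (- y) * tail_poly n s y a"
  by (simp add: binsum_def tail_poly_def upper_gamma_def sum_distrib_left mult_ac)

lemma DERIV_binsum:
  assumes "\<And>i l. i \<le> n \<Longrightarrow> l \<le> i \<Longrightarrow> (f i l has_real_derivative f' i l) (at y)"
  shows "((\<lambda>y. binsum n s (\<lambda>i l. f i l y)) has_real_derivative binsum n s f') (at y)"
  unfolding binsum_def
  by (auto intro!: derivative_eq_intros assms sum.cong)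

lemma binsum_uminus: "binsum n s (\<lambda>i l. - f i l) = - binsum n s f"
  by (simp add: binsum_def sum_negf)

lemma DERIV_binsum_threshold_tail:
  assumes "T > -1"
  shows "((\<lambda>y. binsum n s (\<lambda>i l. threshold_tail n R T i l y)) has_real_derivative
    - (exp (- y) * tail_poly n s y (T * (R + y)))) (at y)"
  using DERIV_binsum[where n = n and s = s and f = "threshold_tail n R T" and f' = "\<lambda>i l. - (exp (- y) * y ^ (n - i) * exp (- (T * (R + y))) * ((T * (R + y)) ^ l / fact l))" and y = y, OF DERIV_threshold_tail[OF assms]]
  by (simp only: binsum_uminus tail_poly_binsum)

lemma DERIV_binsum_ray_tail:
  assumes "k > 0"
  shows "((\<lambda>y. binsum n s (\<lambda>i l. ray_tail n k i l y)) has_real_derivative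
    - (exp (- y) * tail_poly n s y (y / k))) (at y)"
  using DERIV_binsum[where n = n and s = s and f = "ray_tail n k", OF DERIV_ray_tail[OF assms]]
  by (simp only: binsum_uminus tail_poly_binsum)

lemma binsum_tendsto_0:
  assumes "\<And>i l. i \<le> n \<Longrightarrow> l \<le> i \<Longrightarrow> (f i l \<longlongrightarrow> 0) at_top"
  shows "((\<lambda>y. binsum n s (\<lambda>i l. f i l y)) \<longlongrightarrow> 0) at_top"
  unfolding binsum_def by (intro tendsto_null_sum tendsto_mult_right_zero assms) auto

lemma threshold_tail_tendsto_0: "T > -1 \<Longrightarrow> (threshold_tail n R T i l \<longlongrightarrow> 0) at_top"
  unfolding threshold_tail_def
  by (intro tendsto_null_sum tendsto_mult_right_zero upper_gamma_tendsto_0) auto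

lemma ray_tail_tendsto_0: "k > 0 \<Longrightarrow> (ray_tail n k i l \<longlongrightarrow> 0) at_top"
  unfolding ray_tail_def
  by (intro tendsto_null_sum tendsto_mult_right_zero upper_gamma_tendsto_0) auto

text \<open>Here x is the power of the distinguished beam and y the sum of the others. Since
  \<open>ennreal\<close> sends negative reals to 0, it matters that y - s x is nonnegative on the
  region.\<close>

definition joint_integral :: "nat \<Rightarrow> real \<Rightarrow> real \<Rightarrow> nat \<Rightarrow> ennreal" where
  "joint_integral n R T s = (\<integral>\<^sup>+y. \<integral>\<^sup>+x. ennreal (exp (- x - y) * (y - real s * x) ^ n) *
     indicator {(x, y). 0 \<le> x \<and> real s * x \<le> y \<and> T * (R + y) < x} (x, y) \<partial>lborel \<partial>lborel)"

lemma DERIV_tail_poly_exp: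
  "((\<lambda>x. - (exp (- y) * tail_poly n s y x)) has_real_derivative exp (- x - y) * (y - s * x) ^ n) (at x)"
  by (auto intro!: derivative_eq_intros DERIV_tail_poly simp: exp_diff exp_minus field_simps)

text \<open>As 1 / s > T, the lines x = T (R + y) and x = y / s cross at y = b, and the section of
  the region is a proper interval exactly beyond b. Its ends give the two \<open>binsum\<close>
  terms. The second claim is what later allows \<open>enn2real\<close> to return the difference
  unchanged.\<close>

lemma joint_integral_pos:
  assumes "s \<ge> 1" "real s * T < 1" "T > 0" "R > 0"
  defines "b \<equiv> T * R / (1 / real s - T)"
  shows "joint_integral n R T s =
    ennreal (binsum n s (\<lambda>i l. threshold_tail n R T i l b) - binsum n s (\<lambda>i l. ray_tail n s i l b))"
    and "binsum n s (\<lambda>i l. threshold_tail n R T i l b) \<ge> binsum n s (\<lambda>i l. ray_tail n s i l b)"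
proof -
  have pos: "1 / real s - T > 0" using assms by (simp add: field_simps)
  have b0: "b > 0" unfolding b_def using pos assms by simp
  have biff: "T * (R + y) \<le> y / s \<longleftrightarrow> b \<le> y" for y
    unfolding b_def using pos by (simp add: field_simps)
  define G where "G y = exp (- y) * tail_poly n s y (T * (R + y)) - exp (- y) * tail_poly n s y (y / s)" for y
  have inner: "(\<integral>\<^sup>+x. ennreal (exp (- x - y) * (y - real s * x) ^ n) *
      indicator {T * (R + y)..y / s} x \<partial>lborel) = ennreal (G y)" and G0: "0 \<le> G y" if "b \<le> y" for y
  proof -
    have le: "T * (R + y) \<le> y / s" using that biff by simp
    have nn: "0 \<le> exp (- x - y) * (y - real s * x) ^ n" if "x \<le> y / s" for x
    proof -
      have "y - real s * x \<ge> 0" using that assms(1) by (simp add: field_simps)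
      then show ?thesis by simp
    qed
    have "(\<integral>\<^sup>+x. ennreal (exp (- x - y) * (y - real s * x) ^ n) *
      indicator {T * (R + y)..y / s} x \<partial>lborel) =
      - (exp (- y) * tail_poly n s y (y / s)) - - (exp (- y) * tail_poly n s y (T * (R + y)))"
      by (rule nn_integral_FTC_Icc) (use le nn DERIV_tail_poly_exp in auto)
    then show "(\<integral>\<^sup>+x. ennreal (exp (- x - y) * (y - real s * x) ^ n) *
      indicator {T * (R + y)..y / s} x \<partial>lborel) = ennreal (G y)" by (simp add: G_def)
    have "- (exp (- y) * tail_poly n s y (T * (R + y))) \<le> - (exp (- y) * tail_poly n s y (y / s))"
      by (rule DERIV_nonneg_imp_nondecreasing[OF le]) (use DERIV_tail_poly_exp nn in blast)
    then show "0 \<le> G y" by (simp add: G_def)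
  qed
  have "joint_integral n R T s = (\<integral>\<^sup>+y. ennreal (G y) * indicator {b..} y \<partial>lborel)"
    unfolding joint_integral_def
  proof (rule nn_integral_cong)
    fix y :: real
    have "(\<integral>\<^sup>+x. ennreal (exp (- x - y) * (y - real s * x) ^ n) *
     indicator {(x, y). 0 \<le> x \<and> real s * x \<le> y \<and> T * (R + y) < x} (x, y) \<partial>lborel)
     = (\<integral>\<^sup>+x. ennreal (exp (- x - y) * (y - real s * x) ^ n) *
      indicator {T * (R + y)..y / s} x * indicator {b..} y \<partial>lborel)"
    \<comment> \<open>The strict inequality becomes a closed interval, as the integration rule wants
      it, at the cost of one point.\<close>
    proof (rule nn_integral_cong_AE, use AE_lborel_singleton[of "T * (R + y)"] in eventually_elim)
      fix x assume ne: "x \<noteq> T * (R + y)"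
      have "(0 \<le> x \<and> real s * x \<le> y \<and> T * (R + y) < x) \<longleftrightarrow> (x \<in> {T * (R + y)..y / s} \<and> b \<le> y)"
      proof
        assume A: "0 \<le> x \<and> real s * x \<le> y \<and> T * (R + y) < x"
        then have "x \<le> y / s" using assms by (simp add: field_simps)
        with A biff[of y] show "x \<in> {T * (R + y)..y / s} \<and> b \<le> y" by auto
      next
        assume A: "x \<in> {T * (R + y)..y / s} \<and> b \<le> y"
        then have "real s * x \<le> y" using assms by (simp add: field_simps)
        moreover have "0 \<le> T * (R + y)" using A b0 assms by simp
        ultimately show "0 \<le> x \<and> real s * x \<le> y \<and> T * (R + y) < x" using A ne by auto
      qed
      then show "ennreal (exp (- x - y) * (y - real s * x) ^ n) *
          indicator {(x, y). 0 \<le> x \<and> real s * x \<le> y \<and> T * (R + y) < x} (x, y) =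
         ennreal (exp (- x - y) * (y - real s * x) ^ n) * indicator {T * (R + y)..y / real s} x *
         indicator {b..} y"
        by (auto simp: indicator_def)
    qed
    also have "\<dots> = (\<integral>\<^sup>+x. ennreal (exp (- x - y) * (y - real s * x) ^ n) *
      indicator {T * (R + y)..y / s} x \<partial>lborel) * indicator {b..} y"
      by (rule nn_integral_multc) auto
    also have "\<dots> = ennreal (G y) * indicator {b..} y"
      using inner[of y] by (auto simp: indicator_def)
    finally show "(\<integral>\<^sup>+x. ennreal (exp (- x - y) * (y - real s * x) ^ n) *
     indicator {(x, y). 0 \<le> x \<and> real s * x \<le> y \<and> T * (R + y) < x} (x, y) \<partial>lborel)
      = ennreal (G y) * indicator {b..} y" .
  qed
  also have gb: "G \<in> borel_measurable borel"
    unfolding G_def tail_poly_def upper_gamma_def by measurable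
  \<comment> \<open>\<open>F y\<close> is minus the integral of \<open>G\<close> over the half-line
    from y on.\<close>
  define F where "F y = binsum n s (\<lambda>i l. ray_tail n s i l y) - binsum n s (\<lambda>i l. threshold_tail n R T i l y)" for y
  have dF: "(F has_real_derivative G y) (at y)" for y
    unfolding F_def G_def using assms
    by (auto intro!: derivative_eq_intros DERIV_binsum_threshold_tail DERIV_binsum_ray_tail)
  have lF: "(F \<longlongrightarrow> 0) at_top"
    unfolding F_def using assms
    by (intro tendsto_diff[where a = 0 and b = 0, simplified] binsum_tendsto_0 ray_tail_tendsto_0 threshold_tail_tendsto_0) auto
  have "(\<integral>\<^sup>+y. ennreal (G y) * indicator {b..} y \<partial>lborel) = ennreal (0 - F b)"
    by (rule nn_integral_FTC_atLeast) (use gb dF lF G0 in auto)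
  finally show "joint_integral n R T s =
    ennreal (binsum n s (\<lambda>i l. threshold_tail n R T i l b) - binsum n s (\<lambda>i l. ray_tail n s i l b))"
    by (simp add: F_def)
  \<comment> \<open>\<open>F\<close> increases beyond b and tends to 0, so its value at b is at most
    0.\<close>
  have "eventually (\<lambda>y. F b \<le> F y) at_top"
    using eventually_ge_at_top[of b]
    by eventually_elim (rule DERIV_nonneg_imp_nondecreasing, use dF G0 in auto)
  then have "F b \<le> 0" by (rule tendsto_lowerbound[OF lF]) simp
  then show "binsum n s (\<lambda>i l. threshold_tail n R T i l b) \<ge> binsum n s (\<lambda>i l. ray_tail n s i l b)"
    by (simp add: F_def)
qed

text \<open>For s = 0 the condition s x <= y degenerates to y >= 0: the inner integral runs to
  infinity and the outer one starts at 0 instead of a crossing point.\<close>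

lemma joint_integral_0:
  assumes "T > 0" "R > 0"
  shows "joint_integral n R T 0 = ennreal (exp (- T * R) * (fact n / (T + 1) ^ (n + 1)))"
proof -
  have "joint_integral n R T 0 = (\<integral>\<^sup>+y. ennreal (y ^ n * exp (- T * R) * exp (- (T + 1) * y)) * indicator {0..} y \<partial>lborel)"
    unfolding joint_integral_def
  proof (rule nn_integral_cong)
    fix y :: real
    have "(\<integral>\<^sup>+x. ennreal (exp (- x - y) * (y - real 0 * x) ^ n) *
     indicator {(x, y). 0 \<le> x \<and> real 0 * x \<le> y \<and> T * (R + y) < x} (x, y) \<partial>lborel)
     = (\<integral>\<^sup>+x. ennreal (exp (- x - y) * y ^ n * indicator {0..} y) *
      indicator {T * (R + y)..} x \<partial>lborel)"
    proof (rule nn_integral_cong_AE, use AE_lborel_singleton[of "T * (R + y)"] in eventually_elim)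
      fix x assume ne: "x \<noteq> T * (R + y)"
      have "(0 \<le> x \<and> 0 \<le> y \<and> T * (R + y) < x) \<longleftrightarrow> (x \<in> {T * (R + y)..} \<and> 0 \<le> y)"
        using ne assms by (auto intro: order.trans[of 0 "T * (R + y)"])
      then show "ennreal (exp (- x - y) * (y - real 0 * x) ^ n) *
          indicator {(x, y). 0 \<le> x \<and> real 0 * x \<le> y \<and> T * (R + y) < x} (x, y) =
         ennreal (exp (- x - y) * y ^ n * indicator {0..} y) * indicator {T * (R + y)..} x"
        by (auto simp: indicator_def)
    qed
    also have "\<dots> = ennreal (0 - - (exp (- T * (R + y) - y) * y ^ n * indicator {0..} y))"
    proof (rule nn_integral_FTC_atLeast[where F = "\<lambda>x. - (exp (- x - y) * y ^ n * indicator {0..} y)", THEN trans])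
      show "((\<lambda>x. - (exp (- x - y) * y ^ n * indicator {0..} y)) \<longlongrightarrow> 0) at_top"
      proof -
        have "((\<lambda>x::real. exp (- x - y)) \<longlongrightarrow> 0) at_top" by real_asymp
        from tendsto_minus[OF tendsto_mult_left_zero[OF this, of "y ^ n * indicator {0..} y"]]
        show ?thesis by (simp add: mult.assoc)
      qed
    qed (auto intro!: derivative_eq_intros simp: indicator_def)
    also have "\<dots> = ennreal (y ^ n * exp (- T * R) * exp (- (T + 1) * y)) * indicator {0..} y"
      by (auto simp: indicator_def exp_add[symmetric] exp_diff exp_minus field_simps)
    finally show "(\<integral>\<^sup>+x. ennreal (exp (- x - y) * (y - real 0 * x) ^ n) *
     indicator {(x, y). 0 \<le> x \<and> real 0 * x \<le> y \<and> T * (R + y) < x} (x, y) \<partial>lborel)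
       = ennreal (y ^ n * exp (- T * R) * exp (- (T + 1) * y)) * indicator {0..} y" .
  qed
  also have "\<dots> = ennreal (0 - - (exp (- T * R) * upper_gamma n (T + 1) 0))"
  proof (rule nn_integral_FTC_atLeast[where F = "\<lambda>y. - (exp (- T * R) * upper_gamma n (T + 1) y)", THEN trans])
    show "((\<lambda>y. - (exp (- T * R) * upper_gamma n (T + 1) y)) \<longlongrightarrow> 0) at_top"
      using tendsto_minus[OF tendsto_mult_right_zero[OF upper_gamma_tendsto_0[of "T+1" n], of "exp (- T * R)"]] assms
      by simp
  qed (use assms in \<open>auto intro!: derivative_eq_intros DERIV_upper_gamma\<close>)
  finally show ?thesis by (simp add: upper_gamma_0)
qed


section \<open>The closed formula as an alternating sum\<close>

text \<open>For k T < 1, applying \<open>binsum (N - 2) s\<close> gives the integral of exp(-x-y) (y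
  - s x)^(N-2) over the wedge T (N / rho + y) <= x <= y / k. Letting s and k vary independently is
  what makes the telescoping visible.\<close>

definition tail_diff :: "nat \<Rightarrow> real \<Rightarrow> real \<Rightarrow> nat \<Rightarrow> nat \<Rightarrow> nat \<Rightarrow> real" where
  "tail_diff N \<rho> T k i l = threshold_tail (N - 2) (real N / \<rho>) T i l (bb N \<rho> T k)
     - ray_tail (N - 2) (real k) i l (bb N \<rho> T k)"

lemma xi_eq_binsum:
  "xi N p g = real N / fact (N - 2) *
     (\<Sum>t=1..p. real ((N - 1) choose (t - 1)) * (-1) ^ (t + 1) * binsum (N - 2) (real t - 1) g)"
  by (simp add: xi_def binsum_def)

lemma xi_cong:
  assumes "\<And>i l. i \<le> N - 2 \<Longrightarrow> l \<le> i \<Longrightarrow> f i l = g i l"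
  shows "xi N p f = xi N p g"
  unfolding xi_def using assms by (intro arg_cong2[where f = "(*)"] refl sum.cong) auto

lemma xi_add: "xi N p f + xi N p g = xi N p (\<lambda>i l. f i l + g i l)"
  by (simp only: xi_def sum.distrib distrib_left)

text \<open>The strip between y = (k - 1) x and y = k x is a difference of two wedges.
  \<open>D1\<close> is the threshold part between the two vertices; \<open>E2\<close> restores the
  tail beyond b_k that \<open>D2\<close> cuts off, so both make one ray term starting at b_(k-1);
  \<open>E1\<close> is the ray term of the wedge for k.\<close>

lemma P_mid_eq:
  assumes "2 \<le> N" "2 \<le> k"
  shows "P_mid N \<rho> T k = xi N k (\<lambda>i l. tail_diff N \<rho> T (k - 1) i l - tail_diff N \<rho> T k i l)"
proof -
  have 1: "exp (- T * real N / \<rho>) * (T ^ l / fact l) * D1 N \<rho> T k i l =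
     threshold_tail (N - 2) (real N / \<rho>) T i l (bb N \<rho> T (k - 1)) - threshold_tail (N - 2) (real N / \<rho>) T i l (bb N \<rho> T k)"
    if "i \<le> N - 2" for i l
  proof -
    \<comment> \<open>Truncated subtraction: this rests on i <= N - 2, the range to which
      \<open>xi_cong\<close> restricts i.\<close>
    have n: "N - i + v - 2 = N - 2 - i + v" "N - i + v - 1 = N - 2 - i + v + 1" for v
      using assms that by auto
    have "D1 N \<rho> T k i l = (\<Sum>v=0..l. real (l choose v) * (real N / \<rho>) ^ (l - v) * upper_gamma (N - 2 - i + v) (T + 1) (bb N \<rho> T (k - 1)))
       - (\<Sum>v=0..l. real (l choose v) * (real N / \<rho>) ^ (l - v) * upper_gamma (N - 2 - i + v) (T + 1) (bb N \<rho> T k))"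
      unfolding D1_def upper_gamma_def n sum_subtractf[symmetric]
      by (intro sum.cong refl)
        (simp add: right_diff_distrib sum_subtractf sum_distrib_left power_mult_distrib mult_ac)
    then show ?thesis by (simp add: threshold_tail_def right_diff_distrib)
  qed
  have 2: "1 / ((real k - 1) ^ l * fact l) * D2 N \<rho> T k i l + 1 / ((real k - 1) ^ l * fact l) * E2 N \<rho> T k i l
     = ray_tail (N - 2) (real (k - 1)) i l (bb N \<rho> T (k - 1))" if "i \<le> N - 2" for i l
  proof -
    have n: "N - i + v - 2 = N - 2 - i + v" "N - i + v - 1 = N - 2 - i + v + 1" for v
      using assms that by auto
    have k: "real (k - 1) = real k - 1" using assms by simp
    have "D2 N \<rho> T k i l + E2 N \<rho> T k i l = upper_gamma (N - 2 - i + l) (real k / (real k - 1)) (bb N \<rho> T (k - 1))"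
      unfolding D2_def E2_def upper_gamma_def n Let_def
      by (simp add: power_mult_distrib[symmetric] right_diff_distrib power_divide mult.assoc)
    then show ?thesis
      by (simp only: ray_tail_def k distrib_left[symmetric] diff_add_cancel)
  qed
  have 3: "1 / (real k ^ l * fact l) * E1 N \<rho> T k i l = ray_tail (N - 2) (real k) i l (bb N \<rho> T k)"
    if "i \<le> N - 2" for i l
  proof -
    have n: "N - i + v - 2 = N - 2 - i + v" "N - i + v - 1 = N - 2 - i + v + 1" for v
      using assms that by auto
    show ?thesis
      unfolding E1_def ray_tail_def upper_gamma_def n Let_def
      by (simp add: power_mult_distrib mult.assoc power_divide)
  qed
  show ?thesis
    unfolding P_mid_def xi_add
    using 1 2 3 by (intro xi_cong) (simp add: tail_diff_def algebra_simps)
qed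

text \<open>When m T >= 1 the line y = m x never meets the threshold line inside the quadrant, so
  nothing is subtracted and the whole wedge for m - 1 remains.\<close>

lemma P_last_eq:
  assumes "2 \<le> N" "2 \<le> m"
  shows "P_last N \<rho> T m = xi N m (tail_diff N \<rho> T (m - 1))"
  unfolding P_last_def
proof (rule xi_cong)
  fix i l assume "i \<le> N - 2"
  then have n: "N - i + v - 2 = N - 2 - i + v" "N - i + v - 1 = N - 2 - i + v + 1" for v
    using assms by auto
  have k: "real (m - 1) = real m - 1" using assms by simp
  have "exp (- T * real N / \<rho>) * (T ^ l / fact l) * F1 N \<rho> T m i l
      = threshold_tail (N - 2) (real N / \<rho>) T i l (bb N \<rho> T (m - 1))"
    unfolding F1_def threshold_tail_def upper_gamma_def n
    by (simp add: power_mult_distrib mult.assoc)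
  moreover have "1 / ((real m - 1) ^ l * fact l) * F2 N \<rho> T m i l
      = ray_tail (N - 2) (real (m - 1)) i l (bb N \<rho> T (m - 1))"
    unfolding F2_def ray_tail_def upper_gamma_def n Let_def k
    by (simp add: power_mult_distrib mult.assoc power_divide)
  ultimately show "exp (- T * real N / \<rho>) * (T ^ l / fact l) * F1 N \<rho> T m i l -
           1 / ((real m - 1) ^ l * fact l) * F2 N \<rho> T m i l =
           tail_diff N \<rho> T (m - 1) i l" by (simp add: tail_diff_def)
qed

lemma binsum_0: "binsum n 0 g = g 0 0"
proof -
  have "binsum n 0 g = (\<Sum>i=0..n. if i = 0 then g 0 0 else 0)"
    unfolding binsum_def by (intro sum.cong) auto
  then show ?thesis by simp
qed

text \<open>The first strip is y <= x: the full integral for s = 0 minus the wedge below x = y.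
  \<open>C1\<close> is the part up to b_1, and the rate 2 in \<open>C2\<close> is (k + 1) / k at k =
  1.\<close>

lemma P_first_eq:
  assumes "2 \<le> N"
  shows "P_first N \<rho> T = real N / fact (N - 2) *
    (exp (- T * (real N / \<rho>)) * (fact (N - 2) / (T + 1) ^ (N - 1)) - binsum (N - 2) 0 (tail_diff N \<rho> T 1))"
proof -
  have n: "N - 1 = N - 2 + 1" using assms by simp
  have "C1 N \<rho> T = fact (N - 2) / (T + 1) ^ (N - 1) - upper_gamma (N - 2) (T + 1) (bb N \<rho> T 1)"
    unfolding C1_def upper_gamma_def n by (simp add: right_diff_distrib power_mult_distrib mult.assoc)
  moreover have "C2 N \<rho> T = upper_gamma (N - 2) 2 (bb N \<rho> T 1)"
    unfolding C2_def upper_gamma_def n by (simp add: power_mult_distrib mult.assoc)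
  ultimately have "exp (- T * real N / \<rho>) * C1 N \<rho> T + C2 N \<rho> T =
      exp (- T * (real N / \<rho>)) * (fact (N - 2) / (T + 1) ^ (N - 1)) - binsum (N - 2) 0 (tail_diff N \<rho> T 1)"
    unfolding binsum_0 by (simp add: tail_diff_def threshold_tail_def ray_tail_def right_diff_distrib)
  then show ?thesis
    unfolding P_first_def by (rule arg_cong)
qed

text \<open>For fixed t the differences run over k from max 2 t to m, and the last sum cancels their
  end \<open>x t m\<close>. This leaves \<open>x t (t - 1)\<close>, except for t = 1, where k starts
  only at 2 and \<open>x 1 1\<close> remains. The index t = Suc m occurs in the last sum
  alone.\<close>

lemma sum_triangle_telescope:
  fixes w :: "nat \<Rightarrow> 'a :: comm_ring"
  assumes "1 \<le> m"
  shows "(\<Sum>k=2..m. \<Sum>t=1..k. w t * (x t (k - 1) - x t k)) + (\<Sum>t=1..Suc m. w t * x t m)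
      = w 1 * x 1 1 + (\<Sum>t=2..Suc m. w t * x t (t - 1))"
  using assms
proof (induction m rule: dec_induct)
  case base
  show ?case by (simp add: numeral_2_eq_2)
next
  case (step n)
  define A where "A k = (\<Sum>t=1..k. w t * (x t (k - 1) - x t k))" for k
  define B where "B k j = (\<Sum>t=1..k. w t * x t j)" for k j
  \<comment> \<open>Adding row Suc n moves the boundary sum from Suc n back to n, so an induction
    step contributes only the new term at Suc (Suc n).\<close>
  have "A (Suc n) + B (Suc n) (Suc n) = B (Suc n) n"
    unfolding A_def B_def sum.distrib[symmetric] by (intro sum.cong) (auto simp: right_diff_distrib)
  moreover have "B (Suc (Suc n)) (Suc n) = B (Suc n) (Suc n) + w (Suc (Suc n)) * x (Suc (Suc n)) (Suc n)"
    by (simp add: B_def)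
  moreover have "(\<Sum>k=2..Suc n. A k) = (\<Sum>k=2..n. A k) + A (Suc n)"
    using step by simp
  ultimately have "(\<Sum>k=2..Suc n. A k) + B (Suc (Suc n)) (Suc n)
      = ((\<Sum>k=2..n. A k) + B (Suc n) n) + w (Suc (Suc n)) * x (Suc (Suc n)) (Suc n)"
    by (metis (no_types, lifting) add.assoc)
  also have "(\<Sum>k=2..n. A k) + B (Suc n) n = w 1 * x 1 1 + (\<Sum>t=2..Suc n. w t * x t (t - 1))"
    using step.IH by (simp add: A_def B_def)
  finally show ?case by (simp add: A_def B_def add.assoc)
qed

lemma P_first_mid_last_eq:
  assumes "2 \<le> N" "2 \<le> m"
  shows "P_first N \<rho> T + (\<Sum>k=2..m-1. P_mid N \<rho> T k) + P_last N \<rho> T m =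
    real N / fact (N - 2) * (exp (- T * (real N / \<rho>)) * (fact (N - 2) / (T + 1) ^ (N - 1)) +
      (\<Sum>s=1..<m. real ((N - 1) choose s) * (-1) ^ s * binsum (N - 2) (real s) (tail_diff N \<rho> T s)))"
proof -
  define w :: "nat \<Rightarrow> real" where "w t = real ((N - 1) choose (t - 1)) * (-1) ^ (t + 1)" for t
  define x where "x t k = binsum (N - 2) (real t - 1) (tail_diff N \<rho> T k)" for t k
  have sm: "Suc (m - 1) = m" using assms by simp
  have mid: "(\<Sum>k=2..m-1. P_mid N \<rho> T k) = real N / fact (N - 2) * (\<Sum>k=2..m-1. \<Sum>t=1..k. w t * (x t (k - 1) - x t k))"
    unfolding sum_distrib_left[of "real N / fact (N - 2)"] using assms
    by (intro sum.cong refl) (simp add: P_mid_eq xi_eq_binsum binsum_diff w_def x_def sum_distrib_left)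
  have last: "P_last N \<rho> T m = real N / fact (N - 2) * (\<Sum>t=1..Suc (m - 1). w t * x t (m - 1))"
    using assms by (simp add: P_last_eq xi_eq_binsum w_def x_def)
  have "(\<Sum>t=2..Suc (m-1). w t * x t (t - 1)) = (\<Sum>s=1..<m. w (Suc s) * x (Suc s) s)"
    by (rule sum.reindex_bij_witness[of _ Suc "\<lambda>t. t - 1"]) (use sm in auto)
  also have "\<dots> = (\<Sum>s=1..<m. real ((N - 1) choose s) * (-1) ^ s * binsum (N - 2) (real s) (tail_diff N \<rho> T s))"
    by (simp add: w_def x_def)
  \<comment> \<open>The exceptional term for t = 1 is exactly the wedge that
    \<open>P_first_eq\<close> subtracts, so the two cancel.\<close>
  finally have r: "(\<Sum>k=2..m-1. \<Sum>t=1..k. w t * (x t (k - 1) - x t k)) + (\<Sum>t=1..Suc (m - 1). w t * x t (m - 1))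
     = binsum (N - 2) 0 (tail_diff N \<rho> T 1) + (\<Sum>s=1..<m. real ((N - 1) choose s) * (-1) ^ s * binsum (N - 2) (real s) (tail_diff N \<rho> T s))"
    using sum_triangle_telescope[of "m - 1" w x] assms by (simp add: w_def x_def)
  show ?thesis
    unfolding P_first_eq[OF assms(1)] mid last
    using r by (simp only: distrib_left[symmetric] add.assoc) simp
qed

section \<open>Independent exponential variables\<close>

abbreviation expm :: "real measure" where
  "expm \<equiv> density lborel (\<lambda>x. ennreal (exponential_density 1 x))"

lemma prob_space_expm: "prob_space expm"
  by (rule prob_space_exponential_density) simp

lemma product_prob_space_expm: "product_prob_space (\<lambda>_. expm)"
  by (intro product_prob_spaceI prob_space_expm)

lemma nn_integral_expm:
  assumes [measurable]: "g \<in> borel_measurable borel"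
  shows "(\<integral>\<^sup>+y. g y \<partial>expm) = (\<integral>\<^sup>+y. ennreal (exp (- y)) * indicator {0..} y * g y \<partial>lborel)"
  by (subst nn_integral_density)
    (auto intro!: nn_integral_cong simp: exponential_density_def indicator_def)

text \<open>Memorylessness of one exponential variable, obtained by translating the integral by
  x.\<close>

lemma nn_integral_expm_greater:
  assumes [measurable]: "g \<in> borel_measurable borel" and "0 \<le> x"
  shows "(\<integral>\<^sup>+y. indicator {x<..} y * g y \<partial>expm) = ennreal (exp (- x)) * (\<integral>\<^sup>+y. g (y + x) \<partial>expm)"
proof -
  have "(\<integral>\<^sup>+y. indicator {x<..} y * g y \<partial>expm) =
      (\<integral>\<^sup>+y. ennreal (exp (- y)) * indicator {0..} y * (indicator {x<..} y * g y) \<partial>lborel)"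
    by (rule nn_integral_expm) measurable
  also have "\<dots> = (\<integral>\<^sup>+y. ennreal (exp (- (x + y))) * indicator {0..} (x + y) * (indicator {x<..} (x + y) * g (x + y)) \<partial>lborel)"
    by (subst nn_integral_real_affine[where c = 1 and t = x]) auto
  also have "\<dots> = (\<integral>\<^sup>+y. ennreal (exp (- x)) * (ennreal (exp (- y)) * indicator {0..} y * g (y + x)) \<partial>lborel)"
  \<comment> \<open>After the translation y > x reads y > 0, which differs from the support y >= 0
    in one point.\<close>
  proof (rule nn_integral_cong_AE, use AE_lborel_singleton[of "0::real"] in eventually_elim)
    fix y :: real assume "y \<noteq> 0"
    then have "indicator {0..} (x + y) * (indicator {x<..} (x + y) :: ennreal) = indicator {0..} y"
      using assms(2) by (auto simp: indicator_def)
    moreover have "ennreal (exp (- (x + y))) = ennreal (exp (- x)) * ennreal (exp (- y))"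
      by (simp add: ennreal_mult'[symmetric] exp_add[symmetric])
    ultimately show "ennreal (exp (- (x + y))) * indicator {0..} (x + y) * (indicator {x<..} (x + y) * g (x + y))
      = ennreal (exp (- x)) * (ennreal (exp (- y)) * indicator {0..} y * g (y + x))"
      by (simp add: add.commute mult_ac)
  qed
  also have "\<dots> = ennreal (exp (- x)) * (\<integral>\<^sup>+y. g (y + x) \<partial>expm)"
    by (subst nn_integral_cmult) (auto simp: nn_integral_expm)
  finally show ?thesis .
qed

lemma sets_PiM_expm: "sets (Pi\<^sub>M I (\<lambda>_. expm)) = sets (Pi\<^sub>M I (\<lambda>_. borel))"
  by (intro sets_PiM_cong) auto

lemma sum_PiM_measurable:
  assumes "J \<subseteq> I"
  shows "(\<lambda>z. \<Sum>j\<in>J. z j) \<in> borel_measurable (Pi\<^sub>M I (\<lambda>_. expm))"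
  using assms by (intro borel_measurable_sum measurable_compose[OF measurable_component_singleton]) auto

lemma prod_indicator_PiM_measurable:
  assumes "S \<subseteq> I"
  shows "(\<lambda>z. \<Prod>j\<in>S. indicator {x<..} (z j) :: ennreal) \<in> borel_measurable (Pi\<^sub>M I (\<lambda>_. expm))"
  using assms by (intro borel_measurable_prod_ennreal measurable_compose[OF measurable_component_singleton]) auto

text \<open>Given that all coordinates in S exceed x, their excesses are again independent
  exponentials, so the sum behaves like the unconditioned sum plus card S times x. The function f is
  general because integrating out one coordinate replaces it by a translate.\<close>

lemma nn_integral_expm_memoryless:
  fixes J :: "'i set"
  assumes "finite J" "S \<subseteq> J" "0 \<le> x" "f \<in> borel_measurable borel"
  shows "(\<integral>\<^sup>+z. f (\<Sum>j\<in>J. z j) * (\<Prod>j\<in>S. indicator {x<..} (z j)) \<partial>Pi\<^sub>M J (\<lambda>_. expm)) =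
    ennreal (exp (- (real (card S) * x))) * (\<integral>\<^sup>+z. f ((\<Sum>j\<in>J. z j) + real (card S) * x) \<partial>Pi\<^sub>M J (\<lambda>_. expm))"
  using assms
proof (induction J arbitrary: S f rule: finite_induct)
  case empty
  then show ?case by simp
next
  case (insert j J)
  interpret product_prob_space "\<lambda>_ :: 'i. expm" by (rule product_prob_space_expm)
  note [measurable] = insert.prems(3)
  define S' where "S' = S - {j}"
  have S': "S' \<subseteq> J" "finite S'" using insert by (auto simp: S'_def intro: finite_subset)
  \<comment> \<open>Coordinate j carries a constraint only if it lies in S; \<open>a\<close> treats
    both cases at once until the integral over that coordinate is evaluated.\<close>
  define a :: "real \<Rightarrow> ennreal" where "a = (if j \<in> S then indicator {x<..} else (\<lambda>_. 1))"
  have [measurable]: "a \<in> borel_measurable borel" by (simp add: a_def)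
  have sum_upd: "(\<Sum>i\<in>insert j J. (z(j := y)) i) = y + (\<Sum>i\<in>J. z i)" for z and y :: real
    using insert.hyps by (subst sum.insert) (auto intro!: sum.cong)
  have prod_upd: "(\<Prod>i\<in>S. indicator {x<..} ((z(j := y)) i)) = a y * (\<Prod>i\<in>S'. indicator {x<..} (z i) :: ennreal)" for z y
  proof -
    have "(\<Prod>i\<in>S'. indicator {x<..} ((z(j := y)) i)) = (\<Prod>i\<in>S'. indicator {x<..} (z i) :: ennreal)"
      by (rule prod.cong) (auto simp: S'_def)
    moreover have "(\<Prod>i\<in>S. indicator {x<..} ((z(j := y)) i)) = a y * (\<Prod>i\<in>S'. indicator {x<..} ((z(j := y)) i) :: ennreal)"
    proof (cases "j \<in> S")
      case True
      then have "S = insert j S'" "j \<notin> S'" by (auto simp: S'_def)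
      then show ?thesis using S' True by (simp add: a_def)
    qed (simp add: a_def S'_def)
    ultimately show ?thesis by simp
  qed
  \<comment> \<open>The inner integral as a function of coordinate j; its shift counts only the
    constrained coordinates other than j.\<close>
  define g where "g y = (\<integral>\<^sup>+z. f (y + (\<Sum>i\<in>J. z i) + real (card S') * x) \<partial>Pi\<^sub>M J (\<lambda>_. expm))" for y
  have gm [measurable]: "g \<in> borel_measurable borel"
  proof -
    have "sigma_finite_measure (Pi\<^sub>M J (\<lambda>_. expm))"
      by (intro prob_space_imp_sigma_finite prob_space_PiM prob_space_expm)
    moreover have "(\<lambda>(y, z). f (y + (\<Sum>i\<in>J. z i) + real (card S') * x)) \<in> borel_measurable (borel \<Otimes>\<^sub>M Pi\<^sub>M J (\<lambda>_. expm))"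
    proof -
      have [measurable]: "(\<lambda>z. \<Sum>i\<in>J. z i) \<in> borel_measurable (Pi\<^sub>M J (\<lambda>_. expm))"
        by (rule sum_PiM_measurable) simp
      show ?thesis by measurable
    qed
    ultimately show ?thesis
      unfolding g_def by (rule sigma_finite_measure.borel_measurable_nn_integral)
  qed
  have sm: "(\<lambda>z. \<Sum>i\<in>insert j J. z i) \<in> borel_measurable (Pi\<^sub>M (insert j J) (\<lambda>_. expm))"
    by (rule sum_PiM_measurable) simp
  have fm: "(\<lambda>z. f (\<Sum>i\<in>insert j J. z i) * (\<Prod>i\<in>S. indicator {x<..} (z i))) \<in> borel_measurable (Pi\<^sub>M (insert j J) (\<lambda>_. expm))"
    using insert.prems by (intro borel_measurable_times_ennreal measurable_compose[OF sm] prod_indicator_PiM_measurable)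
  have fm2: "(\<lambda>z. f ((\<Sum>i\<in>insert j J. z i) + real (card S) * x)) \<in> borel_measurable (Pi\<^sub>M (insert j J) (\<lambda>_. expm))"
    by (rule measurable_compose[OF sm]) measurable
  have "(\<integral>\<^sup>+z. f (\<Sum>i\<in>insert j J. z i) * (\<Prod>i\<in>S. indicator {x<..} (z i)) \<partial>Pi\<^sub>M (insert j J) (\<lambda>_. expm)) =
     (\<integral>\<^sup>+y. \<integral>\<^sup>+z. f (y + (\<Sum>i\<in>J. z i)) * (a y * (\<Prod>i\<in>S'. indicator {x<..} (z i))) \<partial>Pi\<^sub>M J (\<lambda>_. expm) \<partial>expm)"
    using product_nn_integral_insert_rev[OF insert.hyps(1,2) fm] by (simp only: sum_upd prod_upd)
  also have "\<dots> = (\<integral>\<^sup>+y. a y * (ennreal (exp (- (real (card S') * x))) * g y) \<partial>expm)"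
  proof (rule nn_integral_cong)
    fix y :: real
    have "(\<integral>\<^sup>+z. f (y + (\<Sum>i\<in>J. z i)) * (a y * (\<Prod>i\<in>S'. indicator {x<..} (z i))) \<partial>Pi\<^sub>M J (\<lambda>_. expm))
      = (\<integral>\<^sup>+z. a y * (f (y + (\<Sum>i\<in>J. z i)) * (\<Prod>i\<in>S'. indicator {x<..} (z i))) \<partial>Pi\<^sub>M J (\<lambda>_. expm))"
      by (simp add: mult_ac)
    also have "\<dots> = a y * (\<integral>\<^sup>+z. f (y + (\<Sum>i\<in>J. z i)) * (\<Prod>i\<in>S'. indicator {x<..} (z i)) \<partial>Pi\<^sub>M J (\<lambda>_. expm))"
      using S' by (intro nn_integral_cmult borel_measurable_times_ennreal prod_indicator_PiM_measurable measurable_compose[OF sum_PiM_measurable[of J J], of "\<lambda>u. f (y + u)"]) auto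
    also have "\<dots> = a y * (ennreal (exp (- (real (card S') * x))) * g y)"
      using insert.IH[OF S'(1) insert.prems(2), of "\<lambda>u. f (y + u)"] by (simp add: g_def add.assoc)
    finally show "(\<integral>\<^sup>+z. f (y + (\<Sum>i\<in>J. z i)) * (a y * (\<Prod>i\<in>S'. indicator {x<..} (z i))) \<partial>Pi\<^sub>M J (\<lambda>_. expm))
      = a y * (ennreal (exp (- (real (card S') * x))) * g y)" .
  qed
  also have "\<dots> = ennreal (exp (- (real (card S) * x))) * (\<integral>\<^sup>+y. g (y + real (if j \<in> S then 1 else 0) * x) \<partial>expm)"
  proof (cases "j \<in> S")
    case True
    then have "card S = Suc (card S')"
      using card_Suc_Diff1[of S j] S' by (simp add: S'_def)
    then have e: "ennreal (exp (- (real (card S) * x))) = ennreal (exp (- x)) * ennreal (exp (- (real (card S') * x)))"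
      by (simp add: ennreal_mult'[symmetric] exp_add[symmetric] algebra_simps)
    have "(\<integral>\<^sup>+y. a y * (ennreal (exp (- (real (card S') * x))) * g y) \<partial>expm)
      = ennreal (exp (- x)) * (\<integral>\<^sup>+y. ennreal (exp (- (real (card S') * x))) * g (y + x) \<partial>expm)"
      unfolding a_def using True by (simp add: nn_integral_expm_greater[OF _ insert.prems(2)])
    also have "\<dots> = ennreal (exp (- (real (card S) * x))) * (\<integral>\<^sup>+y. g (y + x) \<partial>expm)"
      unfolding e by (subst nn_integral_cmult) (auto simp: mult.assoc)
    finally show ?thesis using True by simp
  next
    case False
    then have "S' = S" by (simp add: S'_def)
    then show ?thesis using False by (simp add: a_def nn_integral_cmult)
  qed
  also have "(\<integral>\<^sup>+y. g (y + real (if j \<in> S then 1 else 0) * x) \<partial>expm) =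
    (\<integral>\<^sup>+z. f ((\<Sum>i\<in>insert j J. z i) + real (card S) * x) \<partial>Pi\<^sub>M (insert j J) (\<lambda>_. expm))"
  proof -
    have c: "real (card S) = real (if j \<in> S then 1 else 0) + real (card S')"
      using card_Suc_Diff1[of S j] S' by (auto simp: S'_def)
    have "(\<integral>\<^sup>+z. f ((\<Sum>i\<in>insert j J. z i) + real (card S) * x) \<partial>Pi\<^sub>M (insert j J) (\<lambda>_. expm)) =
     (\<integral>\<^sup>+y. \<integral>\<^sup>+z. f (y + (\<Sum>i\<in>J. z i) + real (card S) * x) \<partial>Pi\<^sub>M J (\<lambda>_. expm) \<partial>expm)"
      using product_nn_integral_insert_rev[OF insert.hyps(1,2) fm2] by (simp only: sum_upd)
    then show ?thesis
      by (simp add: g_def c algebra_simps)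
  qed
  finally show ?case .
qed

text \<open>The Erlang law of a sum of independent exponentials, applied to the coordinate
  projections, whose laws and independence have to be read off the product measure.\<close>

lemma distr_sum_expm:
  assumes "finite J" "J \<noteq> {}"
  shows "distr (Pi\<^sub>M J (\<lambda>_. expm)) lborel (\<lambda>z. \<Sum>j\<in>J. z j) = density lborel (\<lambda>x. ennreal (erlang_density (card J - 1) 1 x))"
proof -
  interpret P: prob_space "Pi\<^sub>M J (\<lambda>_. expm)"
    by (intro prob_space_PiM prob_space_expm)
  have comp: "distr (Pi\<^sub>M J (\<lambda>_. expm)) borel (\<lambda>z. z j) = expm" if "j \<in> J" for j
  proof -
    have "distr (Pi\<^sub>M J (\<lambda>_. expm)) borel (\<lambda>z. z j) = distr (Pi\<^sub>M J (\<lambda>_. expm)) expm (\<lambda>z. z j)"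
      by (rule distr_cong) auto
    then show ?thesis using distr_PiM_component[of J "\<lambda>_. expm", OF prob_space_expm that] by simp
  qed
  have m: "(\<lambda>z. z j) \<in> borel_measurable (Pi\<^sub>M J (\<lambda>_. expm))" if "j \<in> J" for j
    using measurable_component_singleton[OF that, of "\<lambda>_. expm"] by simp
  have d: "distributed (Pi\<^sub>M J (\<lambda>_. expm)) lborel (\<lambda>z. z j) (\<lambda>x. ennreal (exponential_density 1 x))" if "j \<in> J" for j
    unfolding distributed_def
  proof safe
    have "distr (Pi\<^sub>M J (\<lambda>_. expm)) lborel (\<lambda>z. z j) = distr (Pi\<^sub>M J (\<lambda>_. expm)) borel (\<lambda>z. z j)"
      by (rule distr_cong) auto
    then show "distr (Pi\<^sub>M J (\<lambda>_. expm)) lborel (\<lambda>z. z j) = expm" using comp[OF that] by simp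
  qed (use m[OF that] in auto)
  have i: "P.indep_vars (\<lambda>_. borel) (\<lambda>j z. z j) J"
  proof (subst P.indep_vars_iff_distr_eq_PiM'[OF assms(2) m])
    have "distr (Pi\<^sub>M J (\<lambda>_. expm)) (Pi\<^sub>M J (\<lambda>_. borel)) (\<lambda>x. restrict x J) = distr (Pi\<^sub>M J (\<lambda>_. expm)) (Pi\<^sub>M J (\<lambda>_. expm)) (\<lambda>x. x)"
      by (rule distr_cong) (auto simp: sets_PiM_expm space_PiM PiE_def extensional_restrict)
    also have "\<dots> = Pi\<^sub>M J (\<lambda>i. distr (Pi\<^sub>M J (\<lambda>_. expm)) borel (\<lambda>z. z i))"
      using comp by (auto intro!: PiM_cong)
    finally show "distr (Pi\<^sub>M J (\<lambda>_. expm)) (Pi\<^sub>M J (\<lambda>_. borel)) (\<lambda>x. \<lambda>i\<in>J. x i) =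
      Pi\<^sub>M J (\<lambda>i. distr (Pi\<^sub>M J (\<lambda>_. expm)) borel (\<lambda>z. z i))" .
  qed
  show ?thesis
    using P.exponential_distributed_sum[OF assms, of 1 "\<lambda>j z. z j"] d i
    by (simp add: distributed_def)
qed

lemma nn_integral_sum_expm:
  assumes "finite J" "J \<noteq> {}" and [measurable]: "f \<in> borel_measurable borel"
  shows "(\<integral>\<^sup>+z. f (\<Sum>j\<in>J. z j) \<partial>Pi\<^sub>M J (\<lambda>_. expm)) =
    (\<integral>\<^sup>+v. ennreal (erlang_density (card J - 1) 1 v) * f v \<partial>lborel)"
proof -
  have [measurable]: "(\<lambda>z. \<Sum>j\<in>J. z j) \<in> borel_measurable (Pi\<^sub>M J (\<lambda>_. expm))"
    by (rule sum_PiM_measurable) simp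
  have "(\<integral>\<^sup>+z. f (\<Sum>j\<in>J. z j) \<partial>Pi\<^sub>M J (\<lambda>_. expm)) =
      (\<integral>\<^sup>+v. f v \<partial>distr (Pi\<^sub>M J (\<lambda>_. expm)) lborel (\<lambda>z. \<Sum>j\<in>J. z j))"
    by (subst nn_integral_distr) auto
  then show ?thesis
    by (simp add: distr_sum_expm[OF assms(1,2)] nn_integral_density)
qed

section \<open>Events comparing one coordinate with the others\<close>

lemma pred_finite_ball:
  assumes "finite S" "\<And>j. j \<in> S \<Longrightarrow> Measurable.pred M (P j)"
  shows "Measurable.pred M (\<lambda>z. \<forall>j\<in>S. P j z)"
  using assms by (intro pred_intros_finite) auto

lemma component_expm_measurable:
  "i \<in> I \<Longrightarrow> (\<lambda>z. z i) \<in> borel_measurable (Pi\<^sub>M I (\<lambda>_. expm))"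
  using measurable_component_singleton[of i I "\<lambda>_. expm"] by simp

text \<open>Fix x = z i. Memorylessness removes the conditions on S, the remaining sum is Erlang,
  and after undoing the shift the integrand is exp(-x-y) (y - s x)^n / n! with n = card J -
  1.\<close>

lemma emeasure_dominates_exceeded:
  fixes J :: "'i set"
  assumes "finite J" "J \<noteq> {}" "i \<notin> J" "S \<subseteq> J"
  shows "emeasure (Pi\<^sub>M (insert i J) (\<lambda>_. expm))
      {z \<in> space (Pi\<^sub>M (insert i J) (\<lambda>_. expm)). T * (R + (\<Sum>j\<in>J. z j)) < z i \<and> (\<forall>j\<in>S. z i < z j)}
    = joint_integral (card J - 1) R T (card S) / fact (card J - 1)"
    (is "emeasure ?M ?A = _")
proof -
  interpret product_prob_space "\<lambda>_ :: 'i. expm" by (rule product_prob_space_expm)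
  define n where "n = card J - 1"
  define s where "s = card S"
  have fS: "finite S" using assms finite_subset by auto
  have [measurable]: "(\<lambda>z. \<Sum>j\<in>J. z j) \<in> borel_measurable ?M" "(\<lambda>z. z i) \<in> borel_measurable ?M"
    by (auto intro!: sum_PiM_measurable component_expm_measurable)
  have [measurable]: "Measurable.pred ?M (\<lambda>z. \<forall>j\<in>S. z i < z j)"
    using assms fS by (intro pred_finite_ball borel_measurable_pred_less component_expm_measurable) auto
  have A: "?A \<in> sets ?M" by measurable
  \<comment> \<open>For fixed x the threshold condition depends only on the sum, the form required
    by \<open>nn_integral_expm_memoryless\<close>.\<close>
  define h where "h x y = (indicator {y. T * (R + y) < x} y :: ennreal)" for x y :: real
  have hm [measurable]: "(\<lambda>(x, y). h x y) \<in> borel_measurable (borel \<Otimes>\<^sub>M borel)"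
    unfolding h_def by (simp add: indicator_def of_bool_def case_prod_beta') measurable
  have upd: "(z(i := x)) i = x" "(\<Sum>j\<in>J. (z(i := x)) j) = (\<Sum>j\<in>J. z j)"
      "(\<forall>j\<in>S. x < (z(i := x)) j) = (\<forall>j\<in>S. x < z j)" for z and x :: real
  proof -
    have ne: "(z(i := x)) j = z j" if "j \<in> J" for j using assms that by auto
    then show "(\<Sum>j\<in>J. (z(i := x)) j) = (\<Sum>j\<in>J. z j)" by (intro sum.cong) auto
    show "(\<forall>j\<in>S. x < (z(i := x)) j) = (\<forall>j\<in>S. x < z j)"
      using ne assms by (intro ball_cong) auto
  qed simp
  have ind: "indicator ?A z = h (z i) (\<Sum>j\<in>J. z j) * (\<Prod>j\<in>S. indicator {z i<..} (z j) :: ennreal)"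
    if "z \<in> space ?M" for z
    using that fS by (auto simp: h_def indicator_def prod_zero_iff)
  have "emeasure ?M ?A = (\<integral>\<^sup>+z. indicator ?A z \<partial>?M)" using A by simp
  also have "\<dots> = (\<integral>\<^sup>+x. \<integral>\<^sup>+z. indicator ?A (z(i := x)) \<partial>Pi\<^sub>M J (\<lambda>_. expm) \<partial>expm)"
    using assms A by (intro product_nn_integral_insert_rev) auto
  also have "\<dots> = (\<integral>\<^sup>+x. \<integral>\<^sup>+z. h x (\<Sum>j\<in>J. z j) * (\<Prod>j\<in>S. indicator {x<..} (z j)) \<partial>Pi\<^sub>M J (\<lambda>_. expm) \<partial>expm)"
  proof (intro nn_integral_cong)
    fix x :: real and z assume "z \<in> space (Pi\<^sub>M J (\<lambda>_. expm))"
    then have sp: "z(i := x) \<in> space ?M" by (auto simp: space_PiM PiE_def extensional_def)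
    have "(\<Prod>j\<in>S. indicator {x<..} ((z(i := x)) j)) = (\<Prod>j\<in>S. indicator {x<..} (z j) :: ennreal)"
      using assms by (intro prod.cong) auto
    then show "indicator ?A (z(i := x)) = h x (\<Sum>j\<in>J. z j) * (\<Prod>j\<in>S. indicator {x<..} (z j))"
      unfolding ind[OF sp] upd by simp
  qed
  also have "\<dots> = (\<integral>\<^sup>+x. ennreal (exp (- x)) * indicator {0..} x *
      (\<integral>\<^sup>+z. h x (\<Sum>j\<in>J. z j) * (\<Prod>j\<in>S. indicator {x<..} (z j)) \<partial>Pi\<^sub>M J (\<lambda>_. expm)) \<partial>lborel)"
  proof (rule nn_integral_expm)
    have [measurable]: "(\<lambda>z. \<Sum>j\<in>J. z j) \<in> borel_measurable (Pi\<^sub>M J (\<lambda>_. expm))"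
      by (rule sum_PiM_measurable) simp
    have "(\<lambda>p. \<Prod>j\<in>S. indicator {fst p<..} (snd p j) :: ennreal) \<in> borel_measurable (borel \<Otimes>\<^sub>M Pi\<^sub>M J (\<lambda>_. expm))"
    proof (rule borel_measurable_prod_ennreal)
      fix j assume "j \<in> S"
      then have [measurable]: "(\<lambda>z. z j) \<in> borel_measurable (Pi\<^sub>M J (\<lambda>_. expm))"
        using assms by (intro component_expm_measurable) auto
      show "(\<lambda>p. indicator {fst p<..} (snd p j) :: ennreal) \<in> borel_measurable (borel \<Otimes>\<^sub>M Pi\<^sub>M J (\<lambda>_. expm))"
        by (simp add: indicator_def of_bool_def)
    qed
    then have "(\<lambda>(x, z). h x (\<Sum>j\<in>J. z j) * (\<Prod>j\<in>S. indicator {x<..} (z j))) \<in> borel_measurable (borel \<Otimes>\<^sub>M Pi\<^sub>M J (\<lambda>_. expm))"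
      by (simp add: case_prod_beta')
    then show "(\<lambda>x. \<integral>\<^sup>+z. h x (\<Sum>j\<in>J. z j) * (\<Prod>j\<in>S. indicator {x<..} (z j)) \<partial>Pi\<^sub>M J (\<lambda>_. expm)) \<in> borel_measurable borel"
      by (intro sigma_finite_measure.borel_measurable_nn_integral prob_space_imp_sigma_finite
          prob_space_PiM prob_space_expm)
  qed
  also have "\<dots> = (\<integral>\<^sup>+x. \<integral>\<^sup>+y. ennreal (exp (- x - y) * (y - real s * x) ^ n) *
     indicator {(x, y). 0 \<le> x \<and> real s * x \<le> y \<and> T * (R + y) < x} (x, y) / fact n \<partial>lborel \<partial>lborel)"
  proof (rule nn_integral_cong)
    fix x :: real
    show "ennreal (exp (- x)) * indicator {0..} x *
        (\<integral>\<^sup>+z. h x (\<Sum>j\<in>J. z j) * (\<Prod>j\<in>S. indicator {x<..} (z j)) \<partial>Pi\<^sub>M J (\<lambda>_. expm))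
      = (\<integral>\<^sup>+y. ennreal (exp (- x - y) * (y - real s * x) ^ n) *
         indicator {(x, y). 0 \<le> x \<and> real s * x \<le> y \<and> T * (R + y) < x} (x, y) / fact n \<partial>lborel)"
    proof (cases "0 \<le> x")
      case True
      have "(\<integral>\<^sup>+z. h x (\<Sum>j\<in>J. z j) * (\<Prod>j\<in>S. indicator {x<..} (z j)) \<partial>Pi\<^sub>M J (\<lambda>_. expm))
         = ennreal (exp (- (real s * x))) * (\<integral>\<^sup>+z. h x ((\<Sum>j\<in>J. z j) + real s * x) \<partial>Pi\<^sub>M J (\<lambda>_. expm))"
        unfolding s_def using assms True by (intro nn_integral_expm_memoryless) auto
      also have "(\<integral>\<^sup>+z. h x ((\<Sum>j\<in>J. z j) + real s * x) \<partial>Pi\<^sub>M J (\<lambda>_. expm))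
         = (\<integral>\<^sup>+v. ennreal (erlang_density n 1 v) * h x (v + real s * x) \<partial>lborel)"
        unfolding n_def using assms by (intro nn_integral_sum_expm) auto
      \<comment> \<open>Substitution y = v + s x, back to the actual sum of the other
        powers.\<close>
      also have "\<dots> = (\<integral>\<^sup>+y. ennreal (erlang_density n 1 (y - real s * x)) * h x y \<partial>lborel)"
        by (subst nn_integral_real_affine[where c = 1 and t = "- (real s * x)"]) (auto simp: algebra_simps)
      finally have "ennreal (exp (- x)) * indicator {0..} x *
          (\<integral>\<^sup>+z. h x (\<Sum>j\<in>J. z j) * (\<Prod>j\<in>S. indicator {x<..} (z j)) \<partial>Pi\<^sub>M J (\<lambda>_. expm)) =
          (\<integral>\<^sup>+y. ennreal (exp (- x)) * (ennreal (exp (- (real s * x))) * (ennreal (erlang_density n 1 (y - real s * x)) * h x y)) \<partial>lborel)"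
        using True by (simp add: nn_integral_cmult)
      also have "\<dots> = (\<integral>\<^sup>+y. ennreal (exp (- x - y) * (y - real s * x) ^ n) *
         indicator {(x, y). 0 \<le> x \<and> real s * x \<le> y \<and> T * (R + y) < x} (x, y) / fact n \<partial>lborel)"
      proof (rule nn_integral_cong)
        fix y :: real
        show "ennreal (exp (- x)) * (ennreal (exp (- (real s * x))) * (ennreal (erlang_density n 1 (y - real s * x)) * h x y))
          = ennreal (exp (- x - y) * (y - real s * x) ^ n) *
         indicator {(x, y). 0 \<le> x \<and> real s * x \<le> y \<and> T * (R + y) < x} (x, y) / fact n"
        \<comment> \<open>The Erlang density vanishes at negative arguments; this is the source of
          the condition s x <= y in the region.\<close>
        proof (cases "real s * x \<le> y")
          case le: True
          have "exp (- x) * (exp (- (real s * x)) * erlang_density n 1 (y - real s * x))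
             = exp (- x - y) * (y - real s * x) ^ n / fact n"
            using le by (simp add: erlang_density_def exp_diff exp_minus field_simps)
          moreover have "ennreal (a / fact n) = ennreal a / fact n" if "0 \<le> a" for a :: real
            using that by (simp add: divide_ennreal[symmetric] ennreal_fact)
          ultimately show ?thesis
            using True le by (simp add: h_def indicator_def ennreal_mult'[symmetric])
        qed (simp add: erlang_density_def)
      qed
      finally show ?thesis .
    qed simp
  qed
  \<comment> \<open>The order is exchanged because \<open>joint_integral\<close> has y outside, so
    that the crossing point bounds the outer integral.\<close>
  also have "\<dots> = (\<integral>\<^sup>+y. \<integral>\<^sup>+x. ennreal (exp (- x - y) * (y - real s * x) ^ n) *
     indicator {(x, y). 0 \<le> x \<and> real s * x \<le> y \<and> T * (R + y) < x} (x, y) / fact n \<partial>lborel \<partial>lborel)"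
    by (rule lborel_pair.Fubini') (simp add: indicator_def of_bool_def case_prod_beta')
  also have "\<dots> = joint_integral n R T s / fact n"
    unfolding joint_integral_def
    by (simp add: divide_ennreal_def nn_integral_multc indicator_def of_bool_def case_prod_beta')
  finally show ?thesis by (simp add: n_def s_def)
qed

section \<open>Inclusion-exclusion over the coordinates above a given one\<close>

lemma sum_Pow_card:
  fixes g :: "nat \<Rightarrow> 'a :: comm_semiring_1"
  assumes "finite J"
  shows "(\<Sum>S\<in>Pow J. g (card S)) = (\<Sum>s=0..card J. of_nat (card J choose s) * g s)"
proof -
  have "(\<Sum>S\<in>Pow J. g (card S)) = (\<Sum>s=0..card J. \<Sum>S\<in>{S\<in>Pow J. card S = s}. g (card S))"
    using assms by (intro sum.group[symmetric]) (auto intro: card_mono)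
  also have "\<dots> = (\<Sum>s=0..card J. of_nat (card J choose s) * g s)"
  proof (rule sum.cong)
    fix s
    have "(\<Sum>S\<in>{S\<in>Pow J. card S = s}. g (card S)) = of_nat (card {S\<in>Pow J. card S = s}) * g s"
      by simp
    then show "(\<Sum>S\<in>{S\<in>Pow J. card S = s}. g (card S)) = of_nat (card J choose s) * g s"
      using n_subsets[OF assms, of s] by simp
  qed simp
  finally show ?thesis .
qed

text \<open>Integrating coordinate i first, the tie is a single point. Thus events in which
  different coordinates are maximal overlap only in null sets.\<close>

lemma AE_expm_neq:
  fixes I :: "'i set"
  assumes "finite I" "i \<in> I" "j \<in> I" "i \<noteq> j"
  shows "AE z in Pi\<^sub>M I (\<lambda>_. expm). z i \<noteq> z j"
proof -
  interpret product_prob_space "\<lambda>_ :: 'i. expm" by (rule product_prob_space_expm)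
  define J where "J = I - {i}"
  have I: "I = insert i J" "finite J" "i \<notin> J" "j \<in> J" using assms by (auto simp: J_def)
  let ?A = "{z \<in> space (Pi\<^sub>M (insert i J) (\<lambda>_. expm)). z i = z j}"
  have [measurable]: "(\<lambda>z. z i) \<in> borel_measurable (Pi\<^sub>M (insert i J) (\<lambda>_. expm))"
      "(\<lambda>z. z j) \<in> borel_measurable (Pi\<^sub>M (insert i J) (\<lambda>_. expm))"
    using I by (auto intro!: component_expm_measurable)
  have A: "?A \<in> sets (Pi\<^sub>M (insert i J) (\<lambda>_. expm))" by measurable
  have "emeasure (Pi\<^sub>M (insert i J) (\<lambda>_. expm)) ?A =
      (\<integral>\<^sup>+z. indicator ?A z \<partial>Pi\<^sub>M (insert i J) (\<lambda>_. expm))" using A by simp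
  also have "\<dots> = (\<integral>\<^sup>+z. \<integral>\<^sup>+x. indicator ?A (z(i := x)) \<partial>expm \<partial>Pi\<^sub>M J (\<lambda>_. expm))"
    using I A by (intro product_nn_integral_insert) auto
  also have "\<dots> = (\<integral>\<^sup>+z. 0 \<partial>Pi\<^sub>M J (\<lambda>_. expm))"
  proof (rule nn_integral_cong)
    fix z assume "z \<in> space (Pi\<^sub>M J (\<lambda>_. expm))"
    then have "indicator ?A (z(i := x)) = (indicator {z j} x :: ennreal)" for x
      using I assms by (auto simp: space_PiM PiE_def extensional_def indicator_def)
    moreover have "(\<integral>\<^sup>+x. indicator {c} x \<partial>expm) = 0" for c :: real
    proof -
      have "(\<integral>\<^sup>+x. indicator {c} x \<partial>expm) = (\<integral>\<^sup>+y. ennreal (exp (- y)) * indicator {0..} y * indicator {c} y \<partial>lborel)"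
        by (rule nn_integral_expm) measurable
      also have "\<dots> = (\<integral>\<^sup>+(y::real). 0 \<partial>lborel)"
      proof (rule nn_integral_cong_AE)
        show "AE y in lborel. ennreal (exp (- y)) * indicator {0..} y * indicator {c} y = 0"
          using AE_lborel_singleton[of c] by eventually_elim simp
      qed
      finally show ?thesis by simp
    qed
    ultimately show "(\<integral>\<^sup>+x. indicator ?A (z(i := x)) \<partial>expm) = 0" by (simp only:)
  qed
  finally have "emeasure (Pi\<^sub>M I (\<lambda>_. expm)) {z \<in> space (Pi\<^sub>M I (\<lambda>_. expm)). z i = z j} = 0"
    using I by simp
  moreover have "{z \<in> space (Pi\<^sub>M I (\<lambda>_. expm)). z i = z j} \<in> sets (Pi\<^sub>M I (\<lambda>_. expm))"
    using A I by simp
  ultimately show ?thesis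
    by (intro AE_I[where N = "{z \<in> space (Pi\<^sub>M I (\<lambda>_. expm)). z i = z j}"]) auto
qed

lemma component_le_measurable:
  "i \<in> I \<Longrightarrow> j \<in> I \<Longrightarrow> Measurable.pred (Pi\<^sub>M I (\<lambda>_. expm)) (\<lambda>z. z i \<le> z j)"
  unfolding pred_def by (intro borel_measurable_le component_expm_measurable)

text \<open>The condition SINR > T with its positive denominator cleared; z is the vector of powers
  and R stands for N / rho.\<close>

definition dominates :: "'i set \<Rightarrow> real \<Rightarrow> real \<Rightarrow> 'i \<Rightarrow> ('i \<Rightarrow> real) \<Rightarrow> bool" where
  "dominates I R T i z \<longleftrightarrow> T * (R + (\<Sum>j\<in>I - {i}. z j)) < z i"

lemma dominates_measurable [measurable]:
  assumes "i \<in> I"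
  shows "Measurable.pred (Pi\<^sub>M I (\<lambda>_. expm)) (dominates I R T i)"
proof -
  have [measurable]: "(\<lambda>z. \<Sum>j\<in>I - {i}. z j) \<in> borel_measurable (Pi\<^sub>M I (\<lambda>_. expm))"
      "(\<lambda>z. z i) \<in> borel_measurable (Pi\<^sub>M I (\<lambda>_. expm))"
    using assms by (auto intro!: sum_PiM_measurable component_expm_measurable)
  show ?thesis unfolding dominates_def by measurable
qed

text \<open>That no other coordinate exceeds z i is a product of factors 1 - indicator. Expanding it
  gives a signed sum over subsets S, and the probability belonging to S depends only on its
  cardinality.\<close>

lemma prob_dominates_argmax:
  fixes I :: "'i set"
  assumes "finite I" "i \<in> I" "card I \<ge> 2"
  shows "measure (Pi\<^sub>M I (\<lambda>_. expm))
      {z \<in> space (Pi\<^sub>M I (\<lambda>_. expm)). dominates I R T i z \<and> (\<forall>j\<in>I - {i}. z j \<le> z i)}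
    = (\<Sum>s=0..card I - 1. real ((card I - 1) choose s) * ((-1) ^ s * (enn2real (joint_integral (card I - 2) R T s) / fact (card I - 2))))"
    (is "measure ?M ?B = _")
proof -
  interpret P: prob_space ?M by (intro prob_space_PiM prob_space_expm)
  define J where "J = I - {i}"
  have I: "I = insert i J" "finite J" "i \<notin> J" and c: "card J = card I - 1" "card J - 1 = card I - 2"
    using assms by (auto simp: J_def)
  have J: "J \<noteq> {}" using c assms by auto
  define A where "A S = {z \<in> space ?M. T * (R + (\<Sum>j\<in>J. z j)) < z i \<and> (\<forall>j\<in>S. z i < z j)}" for S
  have A: "A S \<in> sets ?M" if "S \<subseteq> J" for S
  proof -
    have "finite S" using that I finite_subset by auto
    then have [measurable]: "Measurable.pred ?M (\<lambda>z. \<forall>j\<in>S. z i < z j)"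
      using that I by (intro pred_finite_ball borel_measurable_pred_less component_expm_measurable) auto
    have "Measurable.pred ?M (\<lambda>z. dominates I R T i z \<and> (\<forall>j\<in>S. z i < z j))"
      using assms by measurable
    then show ?thesis by (simp add: A_def dominates_def J_def pred_def)
  qed
  have B: "?B \<in> sets ?M"
  proof -
    have [measurable]: "Measurable.pred ?M (\<lambda>z. \<forall>j\<in>I - {i}. z j \<le> z i)"
      using assms by (intro pred_finite_ball component_le_measurable component_expm_measurable) auto
    show ?thesis using assms by measurable
  qed
  have mA: "measure ?M (A S) = enn2real (joint_integral (card I - 2) R T (card S)) / fact (card I - 2)"
    if "S \<subseteq> J" for S
  proof -
    have "emeasure ?M (A S) = joint_integral (card I - 2) R T (card S) / fact (card I - 2)"
      using emeasure_dominates_exceeded[OF I(2) J I(3) that, of T R, folded I(1)] by (simp only: A_def c(2))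
    then have "measure ?M (A S) = enn2real (joint_integral (card I - 2) R T (card S) * inverse (fact (card I - 2)))"
      by (simp add: measure_def divide_ennreal_def)
    also have "\<dots> = enn2real (joint_integral (card I - 2) R T (card S)) * enn2real (inverse (ennreal (fact (card I - 2))))"
      by (simp add: enn2real_mult ennreal_fact)
    also have "enn2real (inverse (ennreal (fact (card I - 2)))) = inverse (fact (card I - 2))"
      by (subst inverse_ennreal) auto
    finally show ?thesis by (simp add: divide_inverse)
  qed
  have ind: "indicator ?B z = (\<Sum>S\<in>Pow J. (-1) ^ card S * indicator (A S) z :: real)" if z: "z \<in> space ?M" for z
  proof (cases "dominates I R T i z")
    case False
    then show ?thesis by (auto simp: A_def dominates_def J_def)
  next
    case True
    have "indicator ?B z = (if \<forall>j\<in>J. z j \<le> z i then 1 else 0 :: real)"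
      using z True by (auto simp: J_def)
    also have "\<dots> = (\<Prod>j\<in>J. - indicator {z i<..} (z j) + 1 :: real)"
    proof (cases "\<forall>j\<in>J. z j \<le> z i")
      case True
      then have "(\<Prod>j\<in>J. - indicator {z i<..} (z j) + 1 :: real) = 1"
        by (intro prod.neutral) (auto simp: indicator_def)
      then show ?thesis using True by simp
    next
      case False
      then have "\<exists>j\<in>J. - indicator {z i<..} (z j) + 1 = (0 :: real)"
        by (force simp: indicator_def not_le)
      then show ?thesis using False I(2) by (simp add: prod_zero)
    qed
    also have "\<dots> = (\<Sum>S\<in>Pow J. (\<Prod>j\<in>S. - indicator {z i<..} (z j)) * (\<Prod>j\<in>J - S. 1))"
      by (rule prod_add[OF I(2)])
    also have "\<dots> = (\<Sum>S\<in>Pow J. (-1) ^ card S * indicator (A S) z)"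
    proof (rule sum.cong)
      fix S assume "S \<in> Pow J"
      then have S: "finite S" using I finite_subset by auto
      have "(\<Prod>j\<in>S. - indicator {z i<..} (z j) :: real) = (\<Prod>j\<in>S. (-1) * indicator {z i<..} (z j))"
        by simp
      also have "\<dots> = (-1) ^ card S * (\<Prod>j\<in>S. indicator {z i<..} (z j))"
        unfolding prod.distrib by simp
      also have "(\<Prod>j\<in>S. indicator {z i<..} (z j)) = (indicator (A S) z :: real)"
        using True z S by (auto simp: A_def dominates_def J_def indicator_def prod_zero_iff)
      finally show "(\<Prod>j\<in>S. - indicator {z i<..} (z j)) * (\<Prod>j\<in>J - S. 1) = (-1) ^ card S * (indicator (A S) z :: real)"
        by simp
    qed simp
    finally show ?thesis .
  qed
  have "measure ?M ?B = (\<integral>z. indicator ?B z \<partial>?M)" using B by simp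
  also have "\<dots> = (\<integral>z. (\<Sum>S\<in>Pow J. (-1) ^ card S * indicator (A S) z) \<partial>?M)"
    by (rule Bochner_Integration.integral_cong) (auto simp: ind)
  also have "\<dots> = (\<Sum>S\<in>Pow J. (-1) ^ card S * measure ?M (A S))"
    using A by (subst Bochner_Integration.integral_sum) (auto intro!: sum.cong simp: P.emeasure_eq_measure)
  also have "\<dots> = (\<Sum>S\<in>Pow J. (-1) ^ card S * (enn2real (joint_integral (card I - 2) R T (card S)) / fact (card I - 2)))"
    by (intro sum.cong refl arg_cong2[where f = "(*)"] mA) auto
  finally show ?thesis
    using sum_Pow_card[OF I(2), of "\<lambda>s. (-1) ^ s * (enn2real (joint_integral (card I - 2) R T s) / fact (card I - 2))"] c
    by simp
qed

lemma prob_exists_dominates: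
  fixes I :: "'i set"
  assumes "finite I" "card I \<ge> 2" "T \<ge> 0"
  shows "measure (Pi\<^sub>M I (\<lambda>_. expm)) {z \<in> space (Pi\<^sub>M I (\<lambda>_. expm)). \<exists>i\<in>I. dominates I R T i z}
    = real (card I) / fact (card I - 2) *
      (\<Sum>s=0..card I - 1. real ((card I - 1) choose s) * (-1) ^ s * enn2real (joint_integral (card I - 2) R T s))"
    (is "measure ?M _ = _")
proof -
  interpret P: prob_space ?M by (intro prob_space_PiM prob_space_expm)
  define B where "B i = {z \<in> space ?M. dominates I R T i z \<and> (\<forall>j\<in>I - {i}. z j \<le> z i)}" for i
  have B: "B i \<in> sets ?M" if "i \<in> I" for i
  proof -
    have [measurable]: "Measurable.pred ?M (\<lambda>z. \<forall>j\<in>I - {i}. z j \<le> z i)"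
      using assms that by (intro pred_finite_ball component_le_measurable component_expm_measurable) auto
    show ?thesis unfolding B_def using that by measurable
  qed
  \<comment> \<open>Adding T z_i to both sides makes the left side independent of i. The condition
    therefore passes from any i to an index with the largest coordinate.\<close>
  have dom: "dominates I R T i z \<longleftrightarrow> T * (R + (\<Sum>j\<in>I. z j)) < (1 + T) * z i" if "i \<in> I" for i z
    using assms that by (simp add: dominates_def sum_diff1 algebra_simps)
  have "{z \<in> space ?M. \<exists>i\<in>I. dominates I R T i z} = (\<Union>i\<in>I. B i)"
  proof safe
    fix z i assume z: "z \<in> space ?M" and i: "i \<in> I" "dominates I R T i z"
    obtain k where k: "k \<in> I" "\<And>j. j \<in> I \<Longrightarrow> z j \<le> z k"
      using assms(1) i(1) obtains_MAX[of I z] by (metis Max_ge empty_iff finite_imageI imageI)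
    have "(1 + T) * z i \<le> (1 + T) * z k"
      using k i assms by (intro mult_left_mono) auto
    then have "dominates I R T k z"
      using i k dom[of i z] dom[of k z] by simp
    then show "z \<in> (\<Union>i\<in>I. B i)" using k z by (auto simp: B_def)
  qed (auto simp: B_def)
  then have "measure ?M {z \<in> space ?M. \<exists>i\<in>I. dominates I R T i z} = measure ?M (\<Union>i\<in>I. B i)" by simp
  also have "\<dots> = (\<Sum>i\<in>I. measure ?M (B i))"
  proof (rule measure_UNION_AE[OF assms(1)])
    show "pairwise (\<lambda>i j. AE z in ?M. z \<notin> B i \<or> z \<notin> B j) I"
    proof (rule pairwiseI)
      fix i j assume ij: "i \<in> I" "j \<in> I" "i \<noteq> j"
      show "AE z in ?M. z \<notin> B i \<or> z \<notin> B j"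
        using AE_expm_neq[OF assms(1) ij]
        by eventually_elim (use ij in \<open>auto simp: B_def intro: antisym\<close>)
    qed
  qed (use B in \<open>auto simp: P.fmeasurable_eq_sets\<close>)
  also have "\<dots> = real (card I) * (\<Sum>s=0..card I - 1. real ((card I - 1) choose s) *
      ((-1) ^ s * (enn2real (joint_integral (card I - 2) R T s) / fact (card I - 2))))"
    using prob_dominates_argmax[OF assms(1) _ assms(2), of _ R T] by (simp add: B_def)
  also have "\<dots> = real (card I) / fact (card I - 2) *
      (\<Sum>s=0..card I - 1. real ((card I - 1) choose s) * (-1) ^ s * enn2real (joint_integral (card I - 2) R T s))"
    by (simp add: sum_distrib_left mult_ac)
  finally show ?thesis .
qed

section \<open>Agreement of the alternating sum with the closed formula\<close>

lemma joint_integral_eq_0: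
  assumes "real s * T \<ge> 1" "T > 0" "R > 0"
  shows "joint_integral n R T s = 0"
proof -
  have "\<not> (0 \<le> x \<and> real s * x \<le> y \<and> T * (R + y) < x)" for x y
  proof
    assume A: "0 \<le> x \<and> real s * x \<le> y \<and> T * (R + y) < x"
    have "x \<le> real s * T * x" using assms A mult_right_mono[of 1 "real s * T" x] by simp
    also have "\<dots> = T * (real s * x)" by simp
    also have "\<dots> \<le> T * y" using A assms by (intro mult_left_mono) auto
    also have "\<dots> < T * (R + y)" using assms by simp
    finally show False using A by simp
  qed
  then have "indicator {(x, y). 0 \<le> x \<and> real s * x \<le> y \<and> T * (R + y) < x} (x, y) = (0 :: ennreal)" for x y
    by (simp only: indicator_def mem_Collect_eq case_prod_conv of_bool_eq)
  then show ?thesis unfolding joint_integral_def by (simp only: mult_zero_right) simp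
qed

lemma prob_exists_dominates_eq:
  assumes "2 \<le> N" "\<rho> > 0" "T > 0"
  shows "measure (Pi\<^sub>M {1..N} (\<lambda>_. expm))
      {z \<in> space (Pi\<^sub>M {1..N} (\<lambda>_. expm)). \<exists>i\<in>{1..N}. dominates {1..N} (real N / \<rho>) T i z} =
    (if T \<ge> 1 then real N / (T + 1) ^ (N - 1) * exp (- T * real N / \<rho>)
     else let m = nat \<lceil>1 / T\<rceil>
       in P_first N \<rho> T + (\<Sum>k=2..m-1. P_mid N \<rho> T k) + P_last N \<rho> T m)"
proof -
  define R where "R = real N / \<rho>"
  have R: "R > 0" using assms by (simp add: R_def)
  define q where "q s = enn2real (joint_integral (N - 2) R T s)" for s
  have N1: "N - 1 = N - 2 + 1" using assms by simp
  have q0: "q 0 = exp (- T * R) * (fact (N - 2) / (T + 1) ^ (N - 1))"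
    unfolding q_def N1 joint_integral_0[OF assms(3) R] using assms by (intro enn2real_ennreal) simp
  have qz: "q s = 0" if "real s * T \<ge> 1" for s
    using joint_integral_eq_0[OF that assms(3) R] by (simp add: q_def)
  have lhs: "measure (Pi\<^sub>M {1..N} (\<lambda>_. expm))
      {z \<in> space (Pi\<^sub>M {1..N} (\<lambda>_. expm)). \<exists>i\<in>{1..N}. dominates {1..N} (real N / \<rho>) T i z} =
      real N / fact (N - 2) * (\<Sum>s=0..N-1. real ((N - 1) choose s) * (-1) ^ s * q s)"
    using prob_exists_dominates[of "{1..N}" T R] assms by (simp add: R_def q_def)
  show ?thesis
  proof (cases "T \<ge> 1")
    case True
    have "(\<Sum>s=0..N-1. real ((N - 1) choose s) * (-1) ^ s * q s) =
        (\<Sum>s=0..N-1. if s = 0 then q 0 else 0)"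
    proof (intro sum.cong refl)
      fix s
      show "real ((N - 1) choose s) * (-1) ^ s * q s = (if s = 0 then q 0 else 0)"
        using qz[of s] True mult_mono[of 1 "real s" 1 T] by (cases "s = 0") auto
    qed
    then have "(\<Sum>s=0..N-1. real ((N - 1) choose s) * (-1) ^ s * q s) = q 0" by simp
    then show ?thesis
      unfolding lhs q0 using True by (simp add: R_def)
  next
    case False
    define m where "m = nat \<lceil>1 / T\<rceil>"
    have T1: "1 / T > 1" using False assms by simp
    have m2: "2 \<le> m" unfolding m_def using T1 by linarith
    \<comment> \<open>The ceiling m is the first s whose integral vanishes.\<close>
    have ms: "s < m \<longleftrightarrow> real s * T < 1" for s
    proof -
      have "s < m \<longleftrightarrow> real s < 1 / T"
        unfolding m_def using less_ceiling_iff[of "int s" "1 / T"] by (simp add: zless_nat_eq_int_zless)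
      then show ?thesis using assms by (simp add: field_simps)
    qed
    have qs: "q s = binsum (N - 2) (real s) (tail_diff N \<rho> T s)" if "1 \<le> s" "s < m" for s
    proof -
      have b: "T * R / (1 / real s - T) = bb N \<rho> T s" by (simp add: R_def bb_def)
      show ?thesis
        using joint_integral_pos[OF that(1) ms[THEN iffD1, OF that(2)] assms(3) R, of "N - 2"]
        unfolding q_def tail_diff_def binsum_diff b R_def[symmetric] by simp
    qed
    \<comment> \<open>Either N - 1 or m - 1 may be the larger upper index. Both ranges are compared
      inside one up to N + m: from N on the binomial coefficient is 0, from m on the integral is
      0.\<close>
    have "(\<Sum>s=0..N-1. real ((N - 1) choose s) * (-1) ^ s * q s)
        = (\<Sum>s=0..<N + m. real ((N - 1) choose s) * (-1) ^ s * q s)"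
      using assms by (intro sum.mono_neutral_left) auto
    also have "\<dots> = (\<Sum>s=0..<m. real ((N - 1) choose s) * (-1) ^ s * q s)"
    proof (intro sum.mono_neutral_right ballI)
      fix s assume "s \<in> {0..<N + m} - {0..<m}"
      then have "\<not> real s * T < 1" using ms[of s] by auto
      then show "real ((N - 1) choose s) * (-1) ^ s * q s = 0" using qz[of s] by simp
    qed auto
    also have "\<dots> = q 0 + (\<Sum>s=1..<m. real ((N - 1) choose s) * (-1) ^ s * q s)"
      using m2 by (simp add: sum.atLeast_Suc_lessThan)
    also have "(\<Sum>s=1..<m. real ((N - 1) choose s) * (-1) ^ s * q s)
        = (\<Sum>s=1..<m. real ((N - 1) choose s) * (-1) ^ s * binsum (N - 2) (real s) (tail_diff N \<rho> T s))"
      by (intro sum.cong refl) (simp add: qs)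
    finally show ?thesis
      unfolding lhs using False P_first_mid_last_eq[OF assms(1) m2, of \<rho> T] q0
      by (simp add: R_def m_def[symmetric] Let_def)
  qed
qed

section \<open>Unitary invariance of the complex Gaussian law\<close>

text \<open>
  The translation invariance of the image measure determines it up to a factor by the usual Fubini
  argument; the unit ball, which is mapped to itself, fixes the factor.
\<close>

lemma lborel_distr_orthogonal_transformation:
  fixes f :: "'a::euclidean_space \<Rightarrow> 'a"
  assumes f: "orthogonal_transformation f"
  shows "distr lborel borel f = lborel"
proof (rule measure_eqI)
  have lin: "linear f" using f by (rule orthogonal_transformation_linear)
  have [measurable]: "f \<in> borel \<rightarrow>\<^sub>M borel"
    using lin by (intro borel_measurable_continuous_onI linear_continuous_on) (simp add: linear_conv_bounded_linear)
  define c where "c = emeasure lborel (ball (0::'a) 1)"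
  have c: "emeasure lborel (ball x 1) = c" for x :: 'a
    unfolding c_def by (simp add: emeasure_ball)
  have c0: "c \<noteq> 0" "c \<noteq> top"
    using unit_ball_vol_pos[of "real DIM('a)"] unfolding c_def by (auto simp: emeasure_ball simp del: unit_ball_vol_pos)
  have translate: "(\<integral>\<^sup>+x. F (x + w) \<partial>lborel) = (\<integral>\<^sup>+x. F x \<partial>lborel)"
    if [measurable]: "F \<in> borel_measurable borel" for F :: "'a \<Rightarrow> ennreal" and w :: 'a
  proof -
    have "(\<integral>\<^sup>+x. F x \<partial>lborel) = (\<integral>\<^sup>+x. F x \<partial>distr lborel borel ((+) w))"
      by (simp add: lborel_distr_plus)
    also have "\<dots> = (\<integral>\<^sup>+x. F (w + x) \<partial>lborel)"
      by (subst nn_integral_distr) auto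
    finally show ?thesis by (simp add: add.commute)
  qed
  fix A assume "A \<in> sets (distr lborel borel f)"
  then have [measurable]: "A \<in> sets borel" by simp
  have [measurable]: "ball (0::'a) 1 \<in> sets borel" by simp
  have [measurable]: "(\<lambda>(x, y). indicator (ball 0 1) (f x - y) :: ennreal) \<in> borel_measurable (borel \<Otimes>\<^sub>M borel)"
    by measurable
  \<comment> \<open>The factor c is written as the volume of the unit ball around f x, creating a
    second variable y for the exchange of integrals.\<close>
  have "emeasure (distr lborel borel f) A * c = (\<integral>\<^sup>+x. indicator A (f x) * c \<partial>lborel)"
  proof -
    have "emeasure (distr lborel borel f) A = (\<integral>\<^sup>+x. indicator A x \<partial>distr lborel borel f)" by simp
    also have "\<dots> = (\<integral>\<^sup>+x. indicator A (f x) \<partial>lborel)" by (rule nn_integral_distr) auto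
    finally show ?thesis by (simp add: nn_integral_multc)
  qed
  also have "\<dots> = (\<integral>\<^sup>+x. \<integral>\<^sup>+y. indicator A (f x) * indicator (ball 0 1) (f x - y) \<partial>lborel \<partial>lborel)"
  proof (rule nn_integral_cong)
    fix x
    have "(\<integral>\<^sup>+y. indicator A (f x) * indicator (ball 0 1) (f x - y) \<partial>lborel)
        = (\<integral>\<^sup>+y. indicator A (f x) * indicator (ball (f x) 1) y \<partial>lborel)"
      by (intro nn_integral_cong) (auto simp: indicator_def dist_norm norm_minus_commute)
    also have "\<dots> = indicator A (f x) * c"
      by (subst nn_integral_cmult_indicator) (auto simp: c)
    finally show "indicator A (f x) * c = (\<integral>\<^sup>+y. indicator A (f x) * indicator (ball 0 1) (f x - y) \<partial>lborel)" ..
  qed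
  also have "\<dots> = (\<integral>\<^sup>+y. \<integral>\<^sup>+x. indicator A (f x) * indicator (ball 0 1) (f x - y) \<partial>lborel \<partial>lborel)"
    by (rule lborel_pair.Fubini'[symmetric]) measurable
  also have "\<dots> = (\<integral>\<^sup>+y. \<integral>\<^sup>+x. indicator A (f x + y) * indicator (ball 0 1) (f x) \<partial>lborel \<partial>lborel)"
  proof (rule nn_integral_cong)
    fix y
    \<comment> \<open>Translating x by a preimage w of y turns f x into f x + y by
      linearity.\<close>
    obtain w where w: "f w = y"
      using orthogonal_transformation_surj[OF f] by (metis surjD)
    have "(\<integral>\<^sup>+x. indicator A (f x) * indicator (ball 0 1) (f x - y) \<partial>lborel)
        = (\<integral>\<^sup>+x. indicator A (f (x + w)) * indicator (ball 0 1) (f (x + w) - y) \<partial>lborel)"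
      by (rule translate[symmetric]) measurable
    then show "(\<integral>\<^sup>+x. indicator A (f x) * indicator (ball 0 1) (f x - y) \<partial>lborel)
        = (\<integral>\<^sup>+x. indicator A (f x + y) * indicator (ball 0 1) (f x) \<partial>lborel)"
      by (simp add: linear_add[OF lin] w)
  qed
  also have "\<dots> = (\<integral>\<^sup>+x. \<integral>\<^sup>+y. indicator A (f x + y) * indicator (ball 0 1) (f x) \<partial>lborel \<partial>lborel)"
    by (rule lborel_pair.Fubini') measurable
  also have "\<dots> = (\<integral>\<^sup>+x. emeasure lborel A * indicator (ball (0::'a) 1) x \<partial>lborel)"
  proof (rule nn_integral_cong)
    fix x
    have "(\<integral>\<^sup>+y. indicator A (f x + y) \<partial>lborel) = (\<integral>\<^sup>+y. indicator A y \<partial>lborel)"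
      using translate[of "indicator A" "f x"] by (simp add: add.commute)
    moreover have "indicator (ball 0 1) (f x) = (indicator (ball 0 1) x :: ennreal)"
      using orthogonal_transformation_norm[OF f, of x] by (simp add: indicator_def)
    ultimately show "(\<integral>\<^sup>+y. indicator A (f x + y) * indicator (ball 0 1) (f x) \<partial>lborel)
        = emeasure lborel A * indicator (ball (0::'a) 1) x"
      by (simp add: nn_integral_multc)
  qed
  also have "\<dots> = emeasure lborel A * c"
    by (simp add: nn_integral_cmult c_def)
  finally show "emeasure (distr lborel borel f) A = emeasure lborel A"
    using c0 by (metis mult_divide_eq_ennreal)
qed simp

section \<open>Product Lebesgue measure and product densities on vectors\<close>

lemma vec_lambda_measurable [measurable]:
  "(\<lambda>f. \<chi> i. f i) \<in> Pi\<^sub>M UNIV (\<lambda>_ :: 'n::finite. borel :: 'a::euclidean_space measure) \<rightarrow>\<^sub>M borel"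
proof (subst borel_measurable_euclidean_space, safe)
  fix b :: "'a ^ 'n" assume "b \<in> Basis"
  then obtain i c where b: "b = axis i c" by (auto simp: Basis_vec_def)
  have [measurable]: "(\<lambda>f. f i) \<in> Pi\<^sub>M UNIV (\<lambda>_ :: 'n. borel :: 'a measure) \<rightarrow>\<^sub>M borel"
    by (rule measurable_component_singleton) simp
  show "(\<lambda>f. (\<chi> i. f i) \<bullet> b) \<in> borel_measurable (Pi\<^sub>M UNIV (\<lambda>_ :: 'n. borel :: 'a measure))"
    by (simp add: b inner_axis)
qed

lemma vec_nth_measurable [measurable]:
  "(\<lambda>v. v $ i) \<in> (borel :: ('a::euclidean_space ^ 'n) measure) \<rightarrow>\<^sub>M borel"
  by (intro borel_measurable_continuous_onI continuous_intros)

text \<open>Lebesgue measure is determined by boxes. A box of vectors is a product of boxes, and the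
  basis vectors \<open>axis i b\<close> match the factors of the two volumes.\<close>

lemma distr_PiM_lborel_vec:
  "distr (Pi\<^sub>M UNIV (\<lambda>_ :: 'n::finite. lborel :: 'a::euclidean_space measure)) borel (\<lambda>f. \<chi> i. f i) = lborel"
proof (rule lborel_eqI[symmetric])
  fix l u :: "'a ^ 'n" assume le: "\<And>b. b \<in> Basis \<Longrightarrow> l \<bullet> b \<le> u \<bullet> b"
  have le': "l $ i \<bullet> b \<le> u $ i \<bullet> b" if "b \<in> Basis" for i b
    using le[of "axis i b"] that by (auto simp: Basis_vec_def inner_axis)
  interpret product_sigma_finite "\<lambda>_ :: 'n. lborel :: 'a measure" by standard
  have sets: "sets (Pi\<^sub>M UNIV (\<lambda>_ :: 'n. lborel :: 'a measure)) = sets (Pi\<^sub>M UNIV (\<lambda>_. borel))"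
    by (intro sets_PiM_cong) auto
  have m: "(\<lambda>f. \<chi> i. f i) \<in> Pi\<^sub>M UNIV (\<lambda>_ :: 'n. lborel :: 'a measure) \<rightarrow>\<^sub>M borel"
    using vec_lambda_measurable measurable_cong_sets[OF sets refl] by blast
  have "(\<lambda>f. \<chi> i. f i) -` box l u \<inter> space (Pi\<^sub>M UNIV (\<lambda>_ :: 'n. lborel :: 'a measure)) = (\<Pi>\<^sub>E i\<in>UNIV. box (l $ i) (u $ i))"
    by (auto simp: space_PiM PiE_def Pi_def mem_box Basis_vec_def inner_axis)
  then have "emeasure (distr (Pi\<^sub>M UNIV (\<lambda>_ :: 'n. lborel :: 'a measure)) borel (\<lambda>f. \<chi> i. f i)) (box l u)
     = (\<Prod>i\<in>UNIV. emeasure lborel (box (l $ i) (u $ i)))"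
    by (simp add: emeasure_distr[OF m] emeasure_PiM)
  also have "\<dots> = (\<Prod>i\<in>UNIV. ennreal (\<Prod>b\<in>Basis. (u $ i - l $ i) \<bullet> b))"
    by (intro prod.cong refl emeasure_lborel_box le')
  also have "\<dots> = ennreal (\<Prod>i\<in>UNIV. \<Prod>b\<in>Basis. (u $ i - l $ i) \<bullet> b)"
    using le' by (intro prod_ennreal prod_nonneg) (auto simp: inner_diff_left)
  also have "(\<Prod>i\<in>UNIV. \<Prod>b\<in>Basis. (u $ i - l $ i) \<bullet> b) = (\<Prod>p\<in>UNIV \<times> Basis. (u - l) \<bullet> (case p of (i, b) \<Rightarrow> axis i b))"
    by (simp add: prod.cartesian_product inner_axis case_prod_beta)
  also have "\<dots> = (\<Prod>b\<in>(\<lambda>(i, b). axis i b) ` (UNIV \<times> Basis). (u - l) \<bullet> b)"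
    by (subst prod.reindex) (auto simp: inj_on_def axis_eq_axis)
  also have "(\<lambda>(i, b). axis i b) ` (UNIV \<times> Basis) = (Basis :: ('a ^ 'n) set)"
    by (auto simp: Basis_vec_def)
  finally show "emeasure (distr (Pi\<^sub>M UNIV (\<lambda>_ :: 'n. lborel :: 'a measure)) borel (\<lambda>f. \<chi> i. f i)) (box l u)
     = ennreal (\<Prod>b\<in>Basis. (u - l) \<bullet> b)" .
qed simp

text \<open>It suffices to test rectangles, where the integral of a product of functions of single
  coordinates factorises.\<close>

lemma PiM_density:
  fixes M :: "'i \<Rightarrow> 'a measure" and f :: "'i \<Rightarrow> 'a \<Rightarrow> ennreal"
  assumes "finite I" "product_sigma_finite M"
    and f: "\<And>i. i \<in> I \<Longrightarrow> f i \<in> borel_measurable (M i)"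
    and sf: "product_sigma_finite (\<lambda>i. density (M i) (f i))"
  shows "Pi\<^sub>M I (\<lambda>i. density (M i) (f i)) = density (Pi\<^sub>M I M) (\<lambda>x. \<Prod>i\<in>I. f i (x i))"
proof -
  interpret product_sigma_finite M by fact
  interpret D: product_sigma_finite "\<lambda>i. density (M i) (f i)" by fact
  have fm: "(\<lambda>x. \<Prod>i\<in>I. f i (x i)) \<in> borel_measurable (Pi\<^sub>M I M)"
    using f by (intro borel_measurable_prod_ennreal measurable_compose[OF measurable_component_singleton]) auto
  show ?thesis
  proof (rule D.PiM_eqI[OF assms(1), symmetric])
    show "sets (density (Pi\<^sub>M I M) (\<lambda>x. \<Prod>i\<in>I. f i (x i))) = sets (Pi\<^sub>M I (\<lambda>i. density (M i) (f i)))"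
      by (auto intro!: sets_PiM_cong)
    fix A assume A: "\<And>i. i \<in> I \<Longrightarrow> A i \<in> sets (density (M i) (f i))"
    then have AI: "Pi\<^sub>E I A \<in> sets (Pi\<^sub>M I M)"
      using assms(1) by (intro sets_PiM_I_finite) auto
    have "emeasure (density (Pi\<^sub>M I M) (\<lambda>x. \<Prod>i\<in>I. f i (x i))) (Pi\<^sub>E I A)
       = (\<integral>\<^sup>+x. (\<Prod>i\<in>I. f i (x i)) * indicator (Pi\<^sub>E I A) x \<partial>Pi\<^sub>M I M)"
      using fm AI by (rule emeasure_density)
    also have "\<dots> = (\<integral>\<^sup>+x. (\<Prod>i\<in>I. f i (x i) * indicator (A i) (x i)) \<partial>Pi\<^sub>M I M)"
    proof (rule nn_integral_cong)
      fix x assume "x \<in> space (Pi\<^sub>M I M)"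
      then have "indicator (Pi\<^sub>E I A) x = (\<Prod>i\<in>I. indicator (A i) (x i) :: ennreal)"
        using assms(1) by (auto simp: space_PiM PiE_def Pi_iff indicator_def prod_zero_iff intro!: prod.neutral[symmetric])
      then show "(\<Prod>i\<in>I. f i (x i)) * indicator (Pi\<^sub>E I A) x = (\<Prod>i\<in>I. f i (x i) * indicator (A i) (x i))"
        by (simp add: prod.distrib)
    qed
    also have "\<dots> = (\<Prod>i\<in>I. \<integral>\<^sup>+y. f i y * indicator (A i) y \<partial>M i)"
      using assms(1) f A by (intro product_nn_integral_prod borel_measurable_times_ennreal) auto
    also have "\<dots> = (\<Prod>i\<in>I. emeasure (density (M i) (f i)) (A i))"
      using f A by (intro prod.cong refl emeasure_density[symmetric]) auto
    finally show "emeasure (density (Pi\<^sub>M I M) (\<lambda>x. \<Prod>i\<in>I. f i (x i))) (Pi\<^sub>E I A)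
       = (\<Prod>i\<in>I. emeasure (density (M i) (f i)) (A i))" .
  qed
qed

section \<open>The squared modulus of a complex Gaussian variable\<close>

lemma cn_density_measurable [measurable]: "cn_density v \<in> borel_measurable borel"
  unfolding cn_density_def by measurable

lemma emeasure_cn_density_cball:
  assumes "0 \<le> a"
  shows "(\<integral>\<^sup>+z. ennreal (cn_density 1 z) * indicator (cball 0 (sqrt a)) z \<partial>lborel) = ennreal (1 - exp (- a))"
proof -
  have cb: "z \<in> cball 0 (sqrt s) \<longleftrightarrow> (cmod z)\<^sup>2 \<le> s" if "0 \<le> s" for z :: complex and s
    using that by (simp add: real_le_rsqrt sqrt_le_D power2_eq_square[symmetric]) (metis norm_ge_zero real_le_lsqrt real_le_rsqrt sqrt_le_D real_sqrt_le_iff real_sqrt_abs abs_norm_cancel)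
  have em: "emeasure lborel (cball (0::complex) (sqrt s)) = ennreal (pi * s)" if "0 \<le> s" for s
    using that by (simp add: emeasure_cball eval_unit_ball_vol)
  \<comment> \<open>The Gaussian is a mixture of indicators of discs, whose areas are known.\<close>
  have layer: "ennreal (exp (- (cmod z)\<^sup>2)) = ennreal (exp (- a)) + (\<integral>\<^sup>+s. ennreal (exp (- s)) * indicator {(cmod z)\<^sup>2..a} s \<partial>lborel)"
    if "(cmod z)\<^sup>2 \<le> a" for z :: complex
  proof -
    have "(\<integral>\<^sup>+s. ennreal (exp (- s)) * indicator {(cmod z)\<^sup>2..a} s \<partial>lborel) = ennreal (- exp (- a) - - exp (- (cmod z)\<^sup>2))"
      using that by (intro nn_integral_FTC_Icc) (auto intro!: derivative_eq_intros)
    then show ?thesis using that by (simp add: ennreal_plus[symmetric] del: ennreal_plus)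
  qed
  have "(\<integral>\<^sup>+z. ennreal (exp (- (cmod z)\<^sup>2)) * indicator (cball 0 (sqrt a)) z \<partial>lborel) =
    (\<integral>\<^sup>+z. ennreal (exp (- a)) * indicator (cball 0 (sqrt a)) z +
      (\<integral>\<^sup>+s. ennreal (exp (- s)) * indicator {0..a} s * indicator {(z, s). (cmod z)\<^sup>2 \<le> s} (z, s) \<partial>lborel) \<partial>lborel)"
  proof (rule nn_integral_cong)
    fix z :: complex
    show "ennreal (exp (- (cmod z)\<^sup>2)) * indicator (cball 0 (sqrt a)) z = ennreal (exp (- a)) * indicator (cball 0 (sqrt a)) z +
      (\<integral>\<^sup>+s. ennreal (exp (- s)) * indicator {0..a} s * indicator {(z, s). (cmod z)\<^sup>2 \<le> s} (z, s) \<partial>lborel)"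
    proof (cases "(cmod z)\<^sup>2 \<le> a")
      case True
      have "(indicator {(cmod z)\<^sup>2..a} s :: ennreal) = indicator {0..a} s * indicator {(z, s). (cmod z)\<^sup>2 \<le> s} (z, s)" for s
        by (auto simp: indicator_def intro: order_trans[OF zero_le_power2])
      then show ?thesis using True layer[OF True] cb[OF assms, of z] by (simp add: mult.assoc)
    next
      case False
      have "(indicator {0..a} s * indicator {(z, s). (cmod z)\<^sup>2 \<le> s} (z, s) :: ennreal) = 0" for s
        using False by (auto simp: indicator_def)
      then have "(\<integral>\<^sup>+s. ennreal (exp (- s)) * indicator {0..a} s * indicator {(z, s). (cmod z)\<^sup>2 \<le> s} (z, s) \<partial>lborel) = 0"
        by (simp only: mult.assoc) simp
      then show ?thesis using False cb[OF assms, of z] by simp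
    qed
  qed
  also have "\<dots> = ennreal (exp (- a)) * ennreal (pi * a) +
      (\<integral>\<^sup>+z. \<integral>\<^sup>+s. ennreal (exp (- s)) * indicator {0..a} s * indicator {(z, s). (cmod z)\<^sup>2 \<le> s} (z, s) \<partial>lborel \<partial>lborel)"
  proof (subst nn_integral_add)
    show "(\<lambda>z::complex. \<integral>\<^sup>+s. ennreal (exp (- s)) * indicator {0..a} s * indicator {(z, s). (cmod z)\<^sup>2 \<le> s} (z, s) \<partial>lborel) \<in> borel_measurable lborel"
      by (simp add: indicator_def of_bool_def case_prod_beta')
    have m: "cball (0::complex) (sqrt a) \<in> sets lborel" by simp
    then show "(\<lambda>z. ennreal (exp (- a)) * indicator (cball (0::complex) (sqrt a)) z) \<in> borel_measurable lborel"
      by measurable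
    have "(\<integral>\<^sup>+z. ennreal (exp (- a)) * indicator (cball (0::complex) (sqrt a)) z \<partial>lborel) = ennreal (exp (- a)) * ennreal (pi * a)"
      unfolding nn_integral_cmult_indicator[OF m] em[OF assms] ..
    then show "(\<integral>\<^sup>+z. ennreal (exp (- a)) * indicator (cball (0::complex) (sqrt a)) z \<partial>lborel) +
       (\<integral>\<^sup>+z. \<integral>\<^sup>+s. ennreal (exp (- s)) * indicator {0..a} s * indicator {(z::complex, s). (cmod z)\<^sup>2 \<le> s} (z, s) \<partial>lborel \<partial>lborel)
      = ennreal (exp (- a)) * ennreal (pi * a) +
       (\<integral>\<^sup>+z. \<integral>\<^sup>+s. ennreal (exp (- s)) * indicator {0..a} s * indicator {(z::complex, s). (cmod z)\<^sup>2 \<le> s} (z, s) \<partial>lborel \<partial>lborel)"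
      by simp
  qed
  also have "(\<integral>\<^sup>+z. \<integral>\<^sup>+s. ennreal (exp (- s)) * indicator {0..a} s * indicator {(z :: complex, s). (cmod z)\<^sup>2 \<le> s} (z, s) \<partial>lborel \<partial>lborel)
     = (\<integral>\<^sup>+s. \<integral>\<^sup>+z. ennreal (exp (- s)) * indicator {0..a} s * indicator {(z :: complex, s). (cmod z)\<^sup>2 \<le> s} (z, s) \<partial>lborel \<partial>lborel)"
    by (rule lborel_pair.Fubini'[symmetric]) (simp add: indicator_def of_bool_def case_prod_beta')
  also have "\<dots> = (\<integral>\<^sup>+s. ennreal (pi * s * exp (- s)) * indicator {0..a} s \<partial>lborel)"
  proof (rule nn_integral_cong)
    fix s :: real
    show "(\<integral>\<^sup>+z. ennreal (exp (- s)) * indicator {0..a} s * indicator {(z :: complex, s). (cmod z)\<^sup>2 \<le> s} (z, s) \<partial>lborel)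
       = ennreal (pi * s * exp (- s)) * indicator {0..a} s"
    proof (cases "s \<in> {0..a}")
      case True
      have "(\<integral>\<^sup>+z. ennreal (exp (- s)) * indicator {0..a} s * indicator {(z :: complex, s). (cmod z)\<^sup>2 \<le> s} (z, s) \<partial>lborel)
        = (\<integral>\<^sup>+z. ennreal (exp (- s)) * indicator (cball (0::complex) (sqrt s)) z \<partial>lborel)"
        using True cb[of s] by (intro nn_integral_cong) (auto simp: indicator_def)
      also have "\<dots> = ennreal (exp (- s)) * ennreal (pi * s)"
        using True em[of s] by (subst nn_integral_cmult_indicator) auto
      finally show ?thesis using True by (simp add: ennreal_mult'[symmetric] mult_ac)
    qed simp
  qed
  also have "\<dots> = ennreal (- (pi * (a + 1) * exp (- a)) - - (pi * (0 + 1) * exp (- 0)))"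
    using assms by (intro nn_integral_FTC_Icc) (auto intro!: derivative_eq_intros simp: algebra_simps)
  also have "ennreal (exp (- a)) * ennreal (pi * a) + \<dots> = ennreal (pi * (1 - exp (- a)))"
  proof -
    \<comment> \<open>This makes pi - pi (a + 1) exp(-a) nonnegative, so the \<open>ennreal\<close>
      sum can be computed in the reals.\<close>
    have "(1 + a) * exp (- a) \<le> exp a * exp (- a)"
      by (intro mult_right_mono) (auto simp: exp_ge_add_one_self)
    then have "(1 + a) * exp (- a) \<le> 1" by (simp add: exp_minus)
    then have "pi * ((1 + a) * exp (- a)) \<le> pi * 1" by (intro mult_left_mono) auto
    then show ?thesis using assms
      by (simp add: ennreal_mult'[symmetric] ennreal_plus[symmetric] algebra_simps del: ennreal_plus)
  qed
  finally have *: "(\<integral>\<^sup>+z. ennreal (exp (- (cmod z)\<^sup>2)) * indicator (cball 0 (sqrt a)) z \<partial>lborel) = ennreal (pi * (1 - exp (- a)))" .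
  have "(\<integral>\<^sup>+z. ennreal (cn_density 1 z) * indicator (cball 0 (sqrt a)) z \<partial>lborel)
     = (\<integral>\<^sup>+z. ennreal (1 / pi) * (ennreal (exp (- (cmod z)\<^sup>2)) * indicator (cball 0 (sqrt a)) z) \<partial>lborel)"
    by (intro nn_integral_cong) (auto simp: cn_density_def indicator_def ennreal_mult'[symmetric])
  also have "\<dots> = ennreal (1 / pi) * ennreal (pi * (1 - exp (- a)))"
  proof -
    have [measurable]: "cball (0::complex) (sqrt a) \<in> sets lborel" by simp
    have "(\<lambda>z::complex. ennreal (exp (- (cmod z)\<^sup>2)) * indicator (cball 0 (sqrt a)) z) \<in> borel_measurable lborel"
      by measurable
    then show ?thesis by (simp only: nn_integral_cmult *)
  qed
  also have "\<dots> = ennreal (1 - exp (- a))"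
    by (simp add: ennreal_mult'[symmetric])
  finally show ?thesis .
qed

lemma cmod_square_exponential:
  assumes "distributed M lborel Z (\<lambda>z. ennreal (cn_density 1 z))"
  shows "distributed M lborel (\<lambda>\<omega>. (cmod (Z \<omega>))\<^sup>2) (exponential_density 1)"
proof (rule exponential_distributedI)
  have Z [measurable]: "Z \<in> M \<rightarrow>\<^sub>M borel" using assms by (simp add: distributed_def)
  show "(\<lambda>\<omega>. (cmod (Z \<omega>))\<^sup>2) \<in> borel_measurable M" by measurable
  fix a :: real assume a: "0 \<le> a"
  have "{\<omega> \<in> space M. (cmod (Z \<omega>))\<^sup>2 \<le> a} = Z -` cball 0 (sqrt a) \<inter> space M"
    using a by (auto simp: real_le_rsqrt) (metis norm_ge_zero power_mono real_sqrt_pow2)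
  then have "emeasure M {\<omega> \<in> space M. (cmod (Z \<omega>))\<^sup>2 \<le> a} = emeasure M (Z -` cball 0 (sqrt a) \<inter> space M)" by simp
  also have "\<dots> = (\<integral>\<^sup>+z. ennreal (cn_density 1 z) * indicator (cball 0 (sqrt a)) z \<partial>lborel)"
    using assms by (intro distributed_emeasure) auto
  finally show "emeasure M {\<omega> \<in> space M. (cmod (Z \<omega>))\<^sup>2 \<le> a} = 1 - ennreal (exp (- a * 1))"
    using emeasure_cn_density_cball[OF a] by (simp add: ennreal_minus[symmetric])
qed simp

section \<open>Orthonormal families and the unitary map they define\<close>

lemma Re_hermitian_inner: "Re (hermitian_inner x y) = x \<bullet> y"
  by (simp add: hermitian_inner_def inner_vec_def inner_complex_def)

text \<open>With the formula for the real part, this makes complex orthogonality to x the same as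
  real orthogonality to both x and i x.\<close>

lemma Im_hermitian_inner: "Im (hermitian_inner x y) = (\<chi> j. \<i> * x $ j) \<bullet> y"
  by (simp add: hermitian_inner_def inner_vec_def inner_complex_def)

lemma hermitian_inner_commute: "hermitian_inner y x = cnj (hermitian_inner x y)"
  by (simp add: hermitian_inner_def mult.commute)

lemma hermitian_inner_self: "hermitian_inner x x = complex_of_real ((norm x)\<^sup>2)"
  by (rule complex_eqI) (simp_all add: Re_hermitian_inner power2_norm_eq_inner Im_hermitian_inner, simp add: inner_vec_def inner_complex_def)

text \<open>A real dimension count: the vectors and their multiples by i span a real subspace of
  dimension at most 2 card A, less than the real dimension of the whole space.\<close>

lemma exists_hermitian_orthogonal:
  fixes \<psi> :: "'n::finite \<Rightarrow> complex ^ 'm"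
  assumes "card A < CARD('m)"
  obtains v where "hermitian_inner v v = 1" "\<And>a. a \<in> A \<Longrightarrow> hermitian_inner (\<psi> a) v = 0"
proof -
  define S where "S = \<psi> ` A \<union> (\<lambda>a. \<chi> j. \<i> * \<psi> a $ j) ` A"
  have "dim S \<le> card S" by (rule dim_le_card') (simp add: S_def)
  also have "\<dots> \<le> card A + card A"
    unfolding S_def by (rule order_trans[OF card_Un_le]) (intro add_mono card_image_le finite)
  also have "\<dots> < DIM(complex ^ 'm)" using assms by simp
  finally obtain x where x: "x \<noteq> 0" "\<And>y. y \<in> span S \<Longrightarrow> orthogonal x y"
    using orthogonal_to_subspace_exists by blast
  define v where "v = (1 / norm x) *\<^sub>R x"
  have "hermitian_inner (\<psi> a) v = 0" if "a \<in> A" for a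
  proof -
    have "\<psi> a \<in> span S" "(\<chi> j. \<i> * \<psi> a $ j) \<in> span S"
      using that by (auto simp: S_def intro!: span_base)
    then have "\<psi> a \<bullet> x = 0" "(\<chi> j. \<i> * \<psi> a $ j) \<bullet> x = 0"
      using x(2) unfolding orthogonal_def by (metis inner_commute)+
    then show ?thesis
      by (intro complex_eqI) (simp_all add: Re_hermitian_inner Im_hermitian_inner v_def)
  qed
  moreover have "hermitian_inner v v = 1"
    using x(1) by (simp add: hermitian_inner_self v_def)
  ultimately show ?thesis using that by blast
qed

text \<open>One missing index is filled at a time, by induction on the size of the complement of A.
  The indices are those of the coordinates, so the completed family is a square unitary
  matrix.\<close>

lemma orthonormal_extension:
  fixes \<psi> :: "'n::finite \<Rightarrow> complex ^ 'n"
  assumes "\<And>a b. a \<in> A \<Longrightarrow> b \<in> A \<Longrightarrow> hermitian_inner (\<psi> a) (\<psi> b) = (if a = b then 1 else 0)"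
  obtains \<psi>' where "\<And>a b. hermitian_inner (\<psi>' a) (\<psi>' b) = (if a = b then 1 else 0)"
    "\<And>a. a \<in> A \<Longrightarrow> \<psi>' a = \<psi> a"
proof -
  have "\<exists>\<psi>'. (\<forall>a b. hermitian_inner (\<psi>' a) (\<psi>' b) = (if a = b then 1 else 0)) \<and> (\<forall>a\<in>A. \<psi>' a = \<psi> a)"
    using assms
  proof (induction "card (- A)" arbitrary: A \<psi>)
    case 0
    then have "- A = {}" by simp
    then have "A = UNIV" by blast
    with 0(2) show ?case by (intro exI[of _ \<psi>]) auto
  next
    case (Suc d)
    then obtain c where c: "c \<notin> A" by (metis card.empty Compl_UNIV_eq UNIV_eq_I nat.distinct(1))
    have "card A < CARD('n)" using c by (intro psubset_card_mono) auto
    then obtain v where v: "hermitian_inner v v = 1" "\<And>a. a \<in> A \<Longrightarrow> hermitian_inner (\<psi> a) v = 0"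
      using exists_hermitian_orthogonal by blast
    have v': "hermitian_inner v (\<psi> a) = 0" if "a \<in> A" for a
      using v(2)[OF that] hermitian_inner_commute[of v "\<psi> a"] by simp
    have "- insert c A = - A - {c}" by auto
    then have "d = card (- insert c A)"
      using Suc(2) c by simp
    moreover have "hermitian_inner ((\<psi>(c := v)) a) ((\<psi>(c := v)) b) = (if a = b then 1 else 0)"
      if "a \<in> insert c A" "b \<in> insert c A" for a b
      using that c v v' Suc(3) by auto
    ultimately obtain \<psi>' where "\<forall>a b. hermitian_inner (\<psi>' a) (\<psi>' b) = (if a = b then 1 else 0)"
        "\<forall>a\<in>insert c A. \<psi>' a = (\<psi>(c := v)) a"
      using Suc(1)[of "insert c A" "\<psi>(c := v)"] by blast
    then show ?case using c by (intro exI[of _ \<psi>']) auto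
  qed
  then show ?thesis using that by blast
qed

text \<open>The isometry property is proved for the inverse V, where orthonormality of the given
  family suffices; in finite dimension it transfers back. V uses conjugated vectors because
  \<open>scalar_product\<close> does not conjugate.\<close>

lemma scalar_product_orthonormal_basis:
  fixes \<psi> :: "'n::finite \<Rightarrow> complex ^ 'n"
  assumes on: "\<And>a b. hermitian_inner (\<psi> a) (\<psi> b) = (if a = b then 1 else 0)"
  shows "orthogonal_transformation (\<lambda>h. \<chi> k. scalar_product h (\<psi> k))"
proof -
  define V where "V c = (\<chi> a. \<Sum>j\<in>UNIV. c $ j * cnj (\<psi> j $ a))" for c :: "complex ^ 'n"
  have sp: "scalar_product (V c) (\<psi> k) = c $ k" for c k
  proof -
    have "scalar_product (V c) (\<psi> k) = (\<Sum>a\<in>UNIV. \<Sum>j\<in>UNIV. c $ j * (cnj (\<psi> j $ a) * \<psi> k $ a))"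
      by (simp add: scalar_product_def V_def sum_distrib_right mult.assoc)
    also have "\<dots> = (\<Sum>j\<in>UNIV. c $ j * hermitian_inner (\<psi> j) (\<psi> k))"
      by (subst sum.swap) (simp add: hermitian_inner_def sum_distrib_left)
    finally show ?thesis by (simp add: on if_distrib[of "\<lambda>x. _ * x"] cong: if_cong)
  qed
  have norm: "norm (V c) = norm c" for c
  proof -
    have "hermitian_inner (V c) (V c) = (\<Sum>a\<in>UNIV. \<Sum>j\<in>UNIV. cnj (c $ j) * (V c $ a * \<psi> j $ a))"
      unfolding hermitian_inner_def
      by (intro sum.cong refl) (simp add: V_def[of c] sum_distrib_right sum_distrib_left mult_ac)
    also have "\<dots> = (\<Sum>j\<in>UNIV. cnj (c $ j) * scalar_product (V c) (\<psi> j))"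
      by (subst sum.swap) (simp add: scalar_product_def sum_distrib_left)
    also have "\<dots> = hermitian_inner c c" by (simp add: sp hermitian_inner_def)
    finally have "complex_of_real ((norm (V c))\<^sup>2) = complex_of_real ((norm c)\<^sup>2)"
      by (simp only: hermitian_inner_self)
    then show ?thesis by (simp only: of_real_eq_iff) (simp add: power2_eq_iff_nonneg)
  qed
  have "linear V"
    by (rule linearI) (simp_all add: V_def vec_eq_iff distrib_right sum.distrib scaleR_sum_right)
  then have V: "orthogonal_transformation V" using norm by (simp add: orthogonal_transformation)
  have "inv V h = (\<chi> k. scalar_product h (\<psi> k))" for h
  proof -
    obtain c where c: "h = V c" using orthogonal_transformation_surj[OF V] by (metis surjD)
    show ?thesis
      unfolding c by (simp add: inv_f_f[OF orthogonal_transformation_inj[OF V]] sp)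
  qed
  then have "(\<lambda>h. \<chi> k. scalar_product h (\<psi> k)) = inv V" by auto
  then show ?thesis using orthogonal_transformation_inv[OF V] by simp
qed

text \<open>The joint density is a function of the norm alone, which is the source of the unitary
  invariance.\<close>

lemma prod_cn_density: "(\<Prod>j\<in>UNIV. cn_density 1 (v $ j)) = exp (- (norm v)\<^sup>2) / pi ^ CARD('n)"
  for v :: "complex ^ 'n::finite"
proof -
  have "(norm v)\<^sup>2 = (\<Sum>j\<in>UNIV. (cmod (v $ j))\<^sup>2)"
    by (simp add: norm_vec_def L2_set_def sum_nonneg)
  then show ?thesis
    by (simp add: cn_density_def prod_dividef exp_sum[symmetric] sum_negf)
qed

section \<open>Independence, joint laws and the Gaussian vector\<close>

lemma (in prob_space) indep_sets_reindex:
  assumes \<sigma>: "inj_on \<sigma> I" and F: "indep_sets F (\<sigma> ` I)"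
  shows "indep_sets (\<lambda>i. F (\<sigma> i)) I"
proof (rule indep_setsI)
  fix A J assume J: "J \<noteq> {}" "J \<subseteq> I" "finite J" and A: "\<forall>j\<in>J. A j \<in> F (\<sigma> j)"
  define B where "B k = A (inv_into J \<sigma> k)" for k
  have \<sigma>J: "inj_on \<sigma> J" using \<sigma> J(2) by (rule inj_on_subset)
  have B: "B (\<sigma> j) = A j" if "j \<in> J" for j using \<sigma>J that by (simp add: B_def)
  have "prob (\<Inter>k\<in>\<sigma> ` J. B k) = (\<Prod>k\<in>\<sigma> ` J. prob (B k))"
    using J A B by (intro indep_setsD[OF F]) auto
  moreover have "(\<Inter>k\<in>\<sigma> ` J. B k) = (\<Inter>j\<in>J. A j)" using B by auto
  moreover have "(\<Prod>k\<in>\<sigma> ` J. prob (B k)) = (\<Prod>j\<in>J. prob (A j))"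
    using \<sigma>J B by (simp add: prod.reindex)
  ultimately show "prob (\<Inter>j\<in>J. A j) = (\<Prod>j\<in>J. prob (A j))" by simp
qed (use F in \<open>auto simp: indep_sets_def\<close>)

text \<open>Carries independence from vector coordinates to beams, which are numbered by naturals
  and embedded into the coordinate type.\<close>

lemma (in prob_space) indep_vars_reindex:
  assumes "inj_on \<sigma> I" "indep_vars M' X (\<sigma> ` I)"
  shows "indep_vars (\<lambda>i. M' (\<sigma> i)) (\<lambda>i. X (\<sigma> i)) I"
  using assms(2) indep_sets_reindex[OF assms(1)] unfolding indep_vars_def by auto

text \<open>A product measure is determined by rectangles, where independence is the product rule.
  This is what permits conditioning on the precoding vectors.\<close>

lemma (in prob_space) distr_pair_indep_rv:
  assumes "indep_rv S X T Y"
  shows "distr M (S \<Otimes>\<^sub>M T) (\<lambda>\<omega>. (X \<omega>, Y \<omega>)) = distr M S X \<Otimes>\<^sub>M distr M T Y"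
proof (rule pair_measure_eqI[symmetric])
  have [measurable]: "X \<in> M \<rightarrow>\<^sub>M S" "Y \<in> M \<rightarrow>\<^sub>M T"
    and ind: "indep_set (sigma_sets (space M) {X -` A \<inter> space M | A. A \<in> sets S})
              (sigma_sets (space M) {Y -` A \<inter> space M | A. A \<in> sets T})"
    using assms by (auto simp: indep_rv_def)
  show "sigma_finite_measure (distr M S X)" "sigma_finite_measure (distr M T Y)"
    by (auto intro!: prob_space_imp_sigma_finite prob_space_distr)
  fix A B assume AB: "A \<in> sets (distr M S X)" "B \<in> sets (distr M T Y)"
  then have [measurable]: "A \<in> sets S" "B \<in> sets T" by auto
  have "(\<lambda>\<omega>. (X \<omega>, Y \<omega>)) -` (A \<times> B) \<inter> space M = (X -` A \<inter> space M) \<inter> (Y -` B \<inter> space M)"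
    by auto
  moreover have "prob ((X -` A \<inter> space M) \<inter> (Y -` B \<inter> space M)) = prob (X -` A \<inter> space M) * prob (Y -` B \<inter> space M)"
    using AB by (intro indep_setD[OF ind]) (auto intro!: sigma_sets.Basic)
  ultimately show "emeasure (distr M S X) A * emeasure (distr M T Y) B
      = emeasure (distr M (S \<Otimes>\<^sub>M T) (\<lambda>\<omega>. (X \<omega>, Y \<omega>))) (A \<times> B)"
    by (simp add: emeasure_distr emeasure_eq_measure ennreal_mult'[symmetric])
qed (simp cong: sets_pair_measure_cong)

locale gaussian_vector = prob_space M for M :: "'w measure" +
  fixes h :: "'w \<Rightarrow> complex ^ 'n::finite"
  assumes indep: "indep_vars (\<lambda>_. borel) (\<lambda>j \<omega>. h \<omega> $ j) UNIV"
    and distr: "\<And>j. distributed M lborel (\<lambda>\<omega>. h \<omega> $ j) (\<lambda>z. ennreal (cn_density 1 z))"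
begin

lemma vector_measurable [measurable]: "h \<in> M \<rightarrow>\<^sub>M borel"
proof -
  have [measurable]: "(\<lambda>\<omega>. h \<omega> $ j) \<in> M \<rightarrow>\<^sub>M borel" for j
    using distr[of j] by (simp add: distributed_def)
  have "(\<lambda>\<omega>. \<lambda>j\<in>UNIV. h \<omega> $ j) \<in> M \<rightarrow>\<^sub>M Pi\<^sub>M UNIV (\<lambda>_. borel)"
    by (rule measurable_restrict) measurable
  from measurable_compose[OF this vec_lambda_measurable] show ?thesis by simp
qed

lemma distr_component: "distr M borel (\<lambda>\<omega>. h \<omega> $ j) = density lborel (\<lambda>z. ennreal (cn_density 1 z))"
proof -
  have "distr M borel (\<lambda>\<omega>. h \<omega> $ j) = distr M lborel (\<lambda>\<omega>. h \<omega> $ j)" by (rule distr_cong) auto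
  then show ?thesis using distr[of j] by (simp add: distributed_def)
qed

text \<open>Independence gives a product of one-coordinate densities on functions;
  \<open>distr_PiM_lborel_vec\<close> moves it to Lebesgue measure on the vector type.\<close>

lemma distr_vector:
  "distr M borel h = density lborel (\<lambda>v. ennreal (exp (- (norm v)\<^sup>2) / pi ^ CARD('n)))"
proof -
  let ?P = "Pi\<^sub>M UNIV (\<lambda>_ :: 'n. lborel :: complex measure)"
  let ?g = "\<lambda>z. ennreal (cn_density 1 z)"
  have "prob_space (distr M borel (\<lambda>\<omega>. h \<omega> $ j))" for j by (rule prob_space_distr) measurable
  then have psf: "product_sigma_finite (\<lambda>_ :: 'n. density lborel ?g)"
    by (intro product_sigma_finite.intro) (simp add: distr_component prob_space_imp_sigma_finite)
  have sets: "sets ?P = sets (Pi\<^sub>M UNIV (\<lambda>_. borel))"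
    by (intro sets_PiM_cong) auto
  have "distr M (Pi\<^sub>M UNIV (\<lambda>_. borel)) (\<lambda>\<omega>. \<lambda>j\<in>UNIV. h \<omega> $ j) = Pi\<^sub>M UNIV (\<lambda>j. distr M borel (\<lambda>\<omega>. h \<omega> $ j))"
    using indep by (subst (asm) indep_vars_iff_distr_eq_PiM) auto
  also have "\<dots> = Pi\<^sub>M UNIV (\<lambda>_ :: 'n. density lborel ?g)"
    by (simp add: distr_component)
  also have "\<dots> = density ?P (\<lambda>x. \<Prod>j\<in>UNIV. ?g (x j))"
    by (rule PiM_density[OF _ _ _ psf]) (auto intro: product_sigma_finite.intro sigma_finite_lborel)
  finally have j: "distr M (Pi\<^sub>M UNIV (\<lambda>_. borel)) (\<lambda>\<omega> j. h \<omega> $ j) = density ?P (\<lambda>x. \<Prod>j\<in>UNIV. ?g (x j))"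
    by (simp add: restrict_def)
  have m1: "(\<lambda>\<omega> j. h \<omega> $ j) \<in> M \<rightarrow>\<^sub>M Pi\<^sub>M UNIV (\<lambda>_. borel)"
    using measurable_restrict[of UNIV "\<lambda>j \<omega>. h \<omega> $ j" M "\<lambda>_. borel"] by (simp add: restrict_def)
  have m2: "(\<lambda>f. \<chi> j. f j) \<in> ?P \<rightarrow>\<^sub>M borel"
    using vec_lambda_measurable measurable_cong_sets[OF sets refl] by blast
  have "distr M borel h = distr (distr M (Pi\<^sub>M UNIV (\<lambda>_. borel)) (\<lambda>\<omega> j. h \<omega> $ j)) borel (\<lambda>f. \<chi> j. f j)"
    by (subst distr_distr[OF vec_lambda_measurable m1]) (simp add: comp_def)
  \<comment> \<open>Each x j is seen as a coordinate of the image vector, so the density factors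
    through the map, as \<open>density_distr\<close> requires.\<close>
  also have "\<dots> = distr (density ?P (\<lambda>x. \<Prod>j\<in>UNIV. ?g ((\<chi> j. x j) $ j))) borel (\<lambda>f. \<chi> j. f j)"
    by (simp add: j)
  also have "\<dots> = density (distr ?P borel (\<lambda>f. \<chi> j. f j)) (\<lambda>v. \<Prod>j\<in>UNIV. ?g (v $ j))"
    by (rule density_distr[symmetric]) (use m2 in measurable)
  also have "\<dots> = density lborel (\<lambda>v. ennreal (exp (- (norm v)\<^sup>2) / pi ^ CARD('n)))"
    unfolding distr_PiM_lborel_vec prod_cn_density[symmetric]
    by (intro density_cong) (auto simp: prod_ennreal cn_density_def)
  finally show ?thesis .
qed

text \<open>Both ingredients are preserved by U: Lebesgue measure, and the density because it
  depends on the norm only.\<close>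

lemma distr_orthogonal_transformation:
  assumes "orthogonal_transformation U"
  shows "distr M borel (\<lambda>\<omega>. U (h \<omega>)) = distr M borel h"
proof -
  define G :: "complex ^ 'n \<Rightarrow> ennreal" where "G = (\<lambda>v. ennreal (exp (- (norm v)\<^sup>2) / pi ^ CARD('n)))"
  have [measurable]: "G \<in> borel_measurable borel" unfolding G_def by measurable
  have [measurable]: "U \<in> borel \<rightarrow>\<^sub>M borel"
    using orthogonal_transformation_linear[OF assms]
    by (intro borel_measurable_continuous_onI linear_continuous_on) (simp add: linear_conv_bounded_linear)
  have GU: "(\<lambda>v. G (U v)) = G"
    by (simp add: G_def orthogonal_transformation_norm[OF assms])
  have "distr M borel (\<lambda>\<omega>. U (h \<omega>)) = distr (distr M borel h) borel U"
    by (subst distr_distr) (auto simp: comp_def)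
  also have "\<dots> = distr (density lborel G) borel U"
    by (simp add: distr_vector G_def)
  also have "\<dots> = density (distr lborel borel U) G"
    using density_distr[of G borel U lborel] by (simp add: GU)
  also have "\<dots> = distr M borel h"
    by (simp add: lborel_distr_orthogonal_transformation[OF assms] distr_vector G_def)
  finally show ?thesis .
qed

lemma distr_components:
  assumes "I \<noteq> {}" "inj_on \<sigma> I"
  shows "distr M (Pi\<^sub>M I (\<lambda>_. borel)) (\<lambda>\<omega>. \<lambda>i\<in>I. (cmod (h \<omega> $ \<sigma> i))\<^sup>2) = Pi\<^sub>M I (\<lambda>_. expm)"
proof -
  have "indep_vars (\<lambda>_. borel) (\<lambda>j \<omega>. h \<omega> $ j) (\<sigma> ` I)"
    by (rule indep_vars_subset[OF indep]) auto
  then have "indep_vars (\<lambda>_. borel) (\<lambda>i \<omega>. h \<omega> $ \<sigma> i) I"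
    by (rule indep_vars_reindex[OF assms(2)])
  then have "indep_vars (\<lambda>_. borel) (\<lambda>i \<omega>. (cmod (h \<omega> $ \<sigma> i))\<^sup>2) I"
    by (rule indep_vars_compose2) measurable
  then have "distr M (Pi\<^sub>M I (\<lambda>_. borel)) (\<lambda>\<omega>. \<lambda>i\<in>I. (cmod (h \<omega> $ \<sigma> i))\<^sup>2)
      = Pi\<^sub>M I (\<lambda>i. distr M borel (\<lambda>\<omega>. (cmod (h \<omega> $ \<sigma> i))\<^sup>2))"
    by (subst (asm) indep_vars_iff_distr_eq_PiM[OF assms(1)]) measurable
  moreover have "distr M borel (\<lambda>\<omega>. (cmod (h \<omega> $ j))\<^sup>2) = expm" for j
  proof -
    have "distr M borel (\<lambda>\<omega>. (cmod (h \<omega> $ j))\<^sup>2) = distr M lborel (\<lambda>\<omega>. (cmod (h \<omega> $ j))\<^sup>2)"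
      by (rule distr_cong) auto
    then show ?thesis
      using cmod_square_exponential[OF distr[of j]] by (simp add: distributed_def)
  qed
  ultimately show ?thesis by simp
qed

text \<open>Embed the beams into the coordinates and complete the vectors to a unitary matrix. The
  projections are then coordinates of a rotated h, which has the same law as h. The bound on card I
  makes the embedding possible.\<close>

lemma distr_projections:
  assumes on: "orthonormal_on I \<phi>" and I: "finite I" "I \<noteq> {}" "card I \<le> CARD('n)"
  shows "distr M (Pi\<^sub>M I (\<lambda>_. borel)) (\<lambda>\<omega>. \<lambda>i\<in>I. (cmod (scalar_product (h \<omega>) (\<phi> i)))\<^sup>2) = Pi\<^sub>M I (\<lambda>_. expm)"
proof -
  obtain \<sigma> :: "nat \<Rightarrow> 'n" where \<sigma>: "inj_on \<sigma> I"
    using card_le_inj[of I "UNIV :: 'n set"] I by auto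
  define \<psi> where "\<psi> a = \<phi> (inv_into I \<sigma> a)" for a
  have \<psi>: "\<psi> (\<sigma> i) = \<phi> i" if "i \<in> I" for i using \<sigma> that by (simp add: \<psi>_def)
  have "hermitian_inner (\<psi> a) (\<psi> b) = (if a = b then 1 else 0)" if "a \<in> \<sigma> ` I" "b \<in> \<sigma> ` I" for a b
    using that on \<sigma> by (auto simp: \<psi> orthonormal_on_def inj_on_eq_iff)
  then obtain \<psi>' where \<psi>': "\<And>a b. hermitian_inner (\<psi>' a) (\<psi>' b) = (if a = b then 1 else 0)"
      "\<And>a. a \<in> \<sigma> ` I \<Longrightarrow> \<psi>' a = \<psi> a"
    using orthonormal_extension[of "\<sigma> ` I" \<psi>] by blast
  define U where "U v = (\<chi> k. scalar_product v (\<psi>' k))" for v :: "complex ^ 'n"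
  have U: "orthogonal_transformation U"
    unfolding U_def by (rule scalar_product_orthonormal_basis[OF \<psi>'(1)])
  have [measurable]: "U \<in> borel \<rightarrow>\<^sub>M borel"
    using orthogonal_transformation_linear[OF U]
    by (intro borel_measurable_continuous_onI linear_continuous_on) (simp add: linear_conv_bounded_linear)
  define X where "X v = (\<lambda>i\<in>I. (cmod (v $ \<sigma> i))\<^sup>2)" for v :: "complex ^ 'n"
  have [measurable]: "X \<in> borel \<rightarrow>\<^sub>M Pi\<^sub>M I (\<lambda>_. borel)"
    unfolding X_def by measurable
  have "(\<lambda>\<omega>. \<lambda>i\<in>I. (cmod (scalar_product (h \<omega>) (\<phi> i)))\<^sup>2) = (\<lambda>\<omega>. X (U (h \<omega>)))"
    by (intro ext) (simp add: X_def U_def \<psi>' \<psi> restrict_def)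
  then have "distr M (Pi\<^sub>M I (\<lambda>_. borel)) (\<lambda>\<omega>. \<lambda>i\<in>I. (cmod (scalar_product (h \<omega>) (\<phi> i)))\<^sup>2)
     = distr (distr M borel (\<lambda>\<omega>. U (h \<omega>))) (Pi\<^sub>M I (\<lambda>_. borel)) X"
    by (subst distr_distr) (auto simp: comp_def)
  also have "\<dots> = distr M (Pi\<^sub>M I (\<lambda>_. borel)) (\<lambda>\<omega>. X (h \<omega>))"
    unfolding distr_orthogonal_transformation[OF U] by (subst distr_distr) (auto simp: comp_def)
  finally show ?thesis
    using distr_components[OF I(2) \<sigma>] by (simp add: X_def)
qed

end

section \<open>Coverage probability\<close>

lemma scalar_product_measurable:
  fixes f g :: "'a \<Rightarrow> complex ^ 'n::finite"
  assumes [measurable]: "f \<in> M \<rightarrow>\<^sub>M borel" "g \<in> M \<rightarrow>\<^sub>M borel"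
  shows "(\<lambda>x. scalar_product (f x) (g x)) \<in> M \<rightarrow>\<^sub>M borel"
  unfolding scalar_product_def by measurable

theorem theorem1:
  fixes M :: "'w measure"
    and h :: "'w \<Rightarrow> complex ^ 'nt"
    and \<phi> :: "nat \<Rightarrow> 'w \<Rightarrow> complex ^ 'nt"
    and N :: nat and \<rho> T :: real
  assumes "prob_space M"
    and "2 \<le> N" and "N \<le> CARD('nt)"
    and "\<rho> > 0" and "T > 0"
    and h_indep: "prob_space.indep_vars M (\<lambda>_. borel) (\<lambda>j \<omega>. h \<omega> $ j) UNIV"
    and h_distr: "\<And>j. distributed M lborel (\<lambda>\<omega>. h \<omega> $ j) (\<lambda>z. ennreal (cn_density 1 z))"
    and \<phi>_orthonormal: "AE \<omega> in M. orthonormal_on {1..N} (\<lambda>n. \<phi> n \<omega>)"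
    and h_\<phi>_indep: "prob_space.indep_rv M borel h
          (Pi\<^sub>M {1..N} (\<lambda>_. borel)) (\<lambda>\<omega>. \<lambda>n\<in>{1..N}. \<phi> n \<omega>)"
  shows "coverage_prob M N \<rho> T h \<phi> =
    (if T \<ge> 1 then real N / (T + 1) ^ (N - 1) * exp (- T * real N / \<rho>)
     else let m = nat \<lceil>1 / T\<rceil>
       in P_first N \<rho> T + (\<Sum>k=2..m-1. P_mid N \<rho> T k) + P_last N \<rho> T m)"
proof -
  interpret prob_space M by fact
  interpret gaussian_vector M h
    using h_indep h_distr by unfold_locales
  define I where "I = {1..N}"
  define P where "P = Pi\<^sub>M I (\<lambda>_. borel :: (complex ^ 'nt) measure)"
  define Q where "Q = Pi\<^sub>M I (\<lambda>_. borel :: real measure)"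
  define \<Phi> where "\<Phi> \<omega> = (\<lambda>n\<in>I. \<phi> n \<omega>)" for \<omega>
  define X where "X v \<psi> = (\<lambda>n\<in>I. (cmod (scalar_product v (\<psi> n)))\<^sup>2)"
    for v :: "complex ^ 'nt" and \<psi> :: "nat \<Rightarrow> complex ^ 'nt"
  define D where "D = {z \<in> space (Pi\<^sub>M I (\<lambda>_. expm)). \<exists>i\<in>I. dominates I (real N / \<rho>) T i z}"
  have I: "finite I" "I \<noteq> {}" "card I \<le> CARD('nt)"
    using assms(2,3) by (auto simp: I_def)
  have ir: "indep_rv borel h P \<Phi>"
    using h_\<phi>_indep by (simp add: P_def \<Phi>_def[abs_def] I_def)
  then have [measurable]: "\<Phi> \<in> M \<rightarrow>\<^sub>M P" by (simp add: indep_rv_def)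
  have Xm [measurable]: "(\<lambda>(v, \<psi>). X v \<psi>) \<in> borel \<Otimes>\<^sub>M P \<rightarrow>\<^sub>M Q"
    unfolding X_def Q_def case_prod_beta'
  proof (rule measurable_restrict)
    fix i assume "i \<in> I"
    then have [measurable]: "(\<lambda>\<psi>. \<psi> i) \<in> P \<rightarrow>\<^sub>M borel"
      unfolding P_def by (rule measurable_component_singleton)
    have [measurable]: "(\<lambda>p. scalar_product (fst p) (snd p i)) \<in> borel \<Otimes>\<^sub>M P \<rightarrow>\<^sub>M borel"
      by (rule scalar_product_measurable) measurable
    show "(\<lambda>p. (cmod (scalar_product (fst p) (snd p i)))\<^sup>2) \<in> borel_measurable (borel \<Otimes>\<^sub>M P)"
      by measurable
  qed
  have Xm' [measurable]: "(\<lambda>v. X v \<psi>) \<in> borel \<rightarrow>\<^sub>M Q" if "\<psi> \<in> space P" for \<psi>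
    using measurable_compose[OF measurable_Pair2'[OF that] Xm] by simp
  have QE: "sets Q = sets (Pi\<^sub>M I (\<lambda>_. expm))" by (simp add: Q_def sets_PiM_expm)
  have D [measurable]: "D \<in> sets Q"
  proof -
    have "Measurable.pred (Pi\<^sub>M I (\<lambda>_. expm)) (\<lambda>z. \<exists>i\<in>I. dominates I (real N / \<rho>) T i z)"
      using I by (intro pred_intros_finite dominates_measurable) auto
    then show ?thesis by (simp add: QE D_def pred_def)
  qed
  \<comment> \<open>Since N / rho > 0 the denominators are positive and can be cleared, so coverage
    becomes a property of the vector of powers.\<close>
  have event: "{\<omega> \<in> space M. (MAX n\<in>{1..N}. SINR N \<rho> (h \<omega>) (\<lambda>i. \<phi> i \<omega>) n) > T}
      = {\<omega> \<in> space M. X (h \<omega>) (\<Phi> \<omega>) \<in> D}"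
  proof (rule Collect_cong, rule conj_cong[OF refl])
    fix \<omega>
    define x where "x n = (cmod (scalar_product (h \<omega>) (\<phi> n \<omega>)))\<^sup>2" for n
    have X: "X (h \<omega>) (\<Phi> \<omega>) = (\<lambda>n\<in>I. x n)"
      by (auto simp: X_def \<Phi>_def x_def)
    have "SINR N \<rho> (h \<omega>) (\<lambda>i. \<phi> i \<omega>) n > T \<longleftrightarrow> dominates I (real N / \<rho>) T n (\<lambda>n\<in>I. x n)"
      if n: "n \<in> I" for n
    proof -
      have "real N / \<rho> > 0" using assms by simp
      then have "real N / \<rho> + (\<Sum>i\<in>I - {n}. x i) > 0"
        by (intro add_pos_nonneg sum_nonneg) (simp_all add: x_def)
      moreover have "SINR N \<rho> (h \<omega>) (\<lambda>i. \<phi> i \<omega>) n = x n / (real N / \<rho> + (\<Sum>i\<in>I - {n}. x i))"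
        by (simp only: SINR_def x_def I_def)
      moreover have "dominates I (real N / \<rho>) T n (\<lambda>n\<in>I. x n) \<longleftrightarrow> T * (real N / \<rho> + (\<Sum>i\<in>I - {n}. x i)) < x n"
        using n by (simp add: dominates_def)
      ultimately show ?thesis by (simp only: pos_less_divide_eq)
    qed
    moreover have "(MAX n\<in>{1..N}. SINR N \<rho> (h \<omega>) (\<lambda>i. \<phi> i \<omega>) n) > T
        \<longleftrightarrow> (\<exists>n\<in>I. SINR N \<rho> (h \<omega>) (\<lambda>i. \<phi> i \<omega>) n > T)"
      unfolding I_def[symmetric] using I by (subst Max_gr_iff) auto
    moreover have "(\<lambda>n\<in>I. x n) \<in> space (Pi\<^sub>M I (\<lambda>_. expm))"
      by (simp add: space_PiM)
    ultimately show "(MAX n\<in>{1..N}. SINR N \<rho> (h \<omega>) (\<lambda>i. \<phi> i \<omega>) n) > T \<longleftrightarrow> X (h \<omega>) (\<Phi> \<omega>) \<in> D"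
      by (auto simp: X D_def)
  qed
  let ?S = "{p \<in> space (borel \<Otimes>\<^sub>M P). X (fst p) (snd p) \<in> D}"
  have S: "?S \<in> sets (borel \<Otimes>\<^sub>M P)"
    using measurable_sets[OF Xm D] by (simp add: vimage_def Int_def case_prod_beta' conj_commute)
  \<comment> \<open>The right-hand side does not contain the vectors: given any orthonormal family,
    the conditional probability is the same constant.\<close>
  have fixed: "emeasure (distr M borel h) {v. X v \<psi> \<in> D} = emeasure (Pi\<^sub>M I (\<lambda>_. expm)) D"
    if on: "orthonormal_on I \<psi>" and sp: "\<psi> \<in> space P" for \<psi>
  proof -
    have "emeasure (distr M borel h) {v. X v \<psi> \<in> D} = emeasure (distr (distr M borel h) Q (\<lambda>v. X v \<psi>)) D"
      using Xm'[OF sp] by (subst emeasure_distr) (auto simp: vimage_def)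
    also have "distr (distr M borel h) Q (\<lambda>v. X v \<psi>) = distr M Q (\<lambda>\<omega>. X (h \<omega>) \<psi>)"
      using Xm'[OF sp] by (subst distr_distr) (auto simp: comp_def)
    also have "\<dots> = Pi\<^sub>M I (\<lambda>_. expm)"
      using distr_projections[OF on I] by (simp add: Q_def X_def)
    finally show ?thesis .
  qed
  interpret pair: pair_sigma_finite "distr M borel h" "distr M P \<Phi>"
    by (auto intro!: pair_sigma_finite.intro prob_space_imp_sigma_finite prob_space_distr)
  have "emeasure M {\<omega> \<in> space M. X (h \<omega>) (\<Phi> \<omega>) \<in> D}
      = emeasure (distr M (borel \<Otimes>\<^sub>M P) (\<lambda>\<omega>. (h \<omega>, \<Phi> \<omega>))) ?S"
  proof (subst emeasure_distr[OF _ S])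
    have "\<Phi> \<omega> \<in> space P" if "\<omega> \<in> space M" for \<omega>
      using measurable_space[OF \<open>\<Phi> \<in> M \<rightarrow>\<^sub>M P\<close> that] .
    then show "emeasure M {\<omega> \<in> space M. X (h \<omega>) (\<Phi> \<omega>) \<in> D} =
        emeasure M ((\<lambda>\<omega>. (h \<omega>, \<Phi> \<omega>)) -` ?S \<inter> space M)"
      by (intro arg_cong2[where f = emeasure] refl) (auto simp: space_pair_measure)
  qed measurable
  also have "\<dots> = emeasure (distr M borel h \<Otimes>\<^sub>M distr M P \<Phi>) ?S"
    by (simp add: distr_pair_indep_rv[OF ir])
  \<comment> \<open>Tonelli in the order that integrates h first, with the precoding vectors held
    fixed.\<close>
  also have "\<dots> = (\<integral>\<^sup>+\<psi>. emeasure (distr M borel h) ((\<lambda>v. (v, \<psi>)) -` ?S) \<partial>distr M P \<Phi>)"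
    using S by (intro pair.emeasure_pair_measure_alt2) (simp cong: sets_pair_measure_cong)
  \<comment> \<open>The outer integral is pulled back to M because orthonormality is assumed there,
    almost surely.\<close>
  also have "\<dots> = (\<integral>\<^sup>+\<omega>. emeasure (distr M borel h) ((\<lambda>v. (v, \<Phi> \<omega>)) -` ?S) \<partial>M)"
  proof (rule nn_integral_distr)
    show "(\<lambda>\<psi>. emeasure (distr M borel h) ((\<lambda>v. (v, \<psi>)) -` ?S)) \<in> borel_measurable (distr M P \<Phi>)"
      using S by (intro pair.measurable_emeasure_Pair2) (simp cong: sets_pair_measure_cong)
  qed measurable
  also have "\<dots> = (\<integral>\<^sup>+\<omega>. emeasure (Pi\<^sub>M I (\<lambda>_. expm)) D \<partial>M)"
  proof (rule nn_integral_cong_AE, use \<phi>_orthonormal AE_space in eventually_elim)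
    case (elim \<omega>)
    then have sp: "\<Phi> \<omega> \<in> space P" using measurable_space[OF \<open>\<Phi> \<in> M \<rightarrow>\<^sub>M P\<close>] by blast
    have "orthonormal_on I (\<Phi> \<omega>)"
      using elim by (simp add: orthonormal_on_def \<Phi>_def I_def)
    moreover have "(\<lambda>v. (v, \<Phi> \<omega>)) -` ?S = {v. X v (\<Phi> \<omega>) \<in> D}"
      using sp by (auto simp: space_pair_measure)
    ultimately show ?case using fixed sp by simp
  qed
  also have "\<dots> = emeasure (Pi\<^sub>M I (\<lambda>_. expm)) D"
    by (simp add: emeasure_space_1)
  finally have "coverage_prob M N \<rho> T h \<phi> = measure (Pi\<^sub>M I (\<lambda>_. expm)) D"
    by (simp only: coverage_prob_def event measure_def)
  then show ?thesis
    using prob_exists_dominates_eq[OF assms(2,4,5)] by (simp only: D_def I_def)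
qed

end
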